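(* Let $K\ge1$ be an integer, $B\in\mathbb R$, and let $r_i$ be the perturbations (depending on $K,B$) defined in the context. Consider the (1,2) random walk $Y'$ defined in the context, with $Y'_0=2$, and its associated $D$ and $M$. In each case below $c\in(0,\infty)$ denotes a constant not depending on $n$. (i) If $p_i=\frac13+r_i$ (and $q_i=1-p_i$) for all $i\ge2$, then as $n\to\infty$, $$P(M=n,D<\infty)\sim\begin{cases}\dfrac{c}{n\log n\cdots\log_{K-2}n\,\log_{K-1}n\,(\log_Kn)^2}, & B=1,\\[2mm] \dfrac{c}{n\log n\cdots\log_{K-2}n\,(\log_{K-1}n)^B}, & B>1,\\[2mm] \dfrac{c}{n\log n\cdots\log_{K-2}n\,(\log_{K-1}n)^{2-B}}, & B<1.\end{cases}$$ (ii) If $p_i=\frac13-r_i$ (and $q_i=1-p_i$) for all $i\ge2$, then as $n\to\infty$, $$P(M=n,D<\infty)\sim\begin{cases}\dfrac{c}{n^{B+2}}, & K=1,\ B>-1,\\[2mm] \dfrac{c}{n(\log n)^2}, & K=1,\ B=-1,\\[2mm] c\,n^B, & K=1,\ B<-1,\\[2mm] \dfrac{c}{n^3\log n\cdots\log_{K-2}n\,(\log_{K-1}n)^B}, & K>1.\end{cases}$$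
   Context: Iterated logarithms: $\log_0 x=x$ and $\log_k x=\log(\log_{k-1}x)$ for $k\ge1$. The expression $n\log n\cdots\log_{K-2}n$ means $\prod_{j=0}^{K-2}\log_j n$ (equal to $1$ if $K=1$); similarly $n^3\log n\cdots\log_{K-2}n$ means $n^3\prod_{j=1}^{K-2}\log_jn$ for $K\ge2$ (empty product $=1$). Perturbations: for $K\ge1$ and $B\in\mathbb R$, $\Lambda(K,i,B)=\sum_{m=0}^{K-2}\frac{1}{\prod_{j=0}^m\log_j i}+\frac{B}{\prod_{j=0}^{K-1}\log_j i}$ (so $\Lambda(1,i,B)=B/i$, $\Lambda(2,i,B)=\frac1i+\frac{B}{i\log i}$). Let $i_0=\min\{i\ge 1:\log_{K-1}i>0,\ |\Lambda(K,i,B)|<1\}$ and $r_i=\Lambda(K,i,B)/3$ for $i\ge i_0$, $r_i=r_{i_0}$ for $i<i_0$. (1,2) random walk: given $q_k,p_k>0$ with $q_k+p_k=1$ ($k\ge2$), $Y'=\{Y'_k\}_{k\ge0}$ is the Markov chain on $\{0,1,2,\dots\}$ with $P(Y'_{k+1}=0|Y'_k=1)=P(Y'_{k+1}=2|Y'_k=0)=1$ and, for $n\ge2$, $P(Y'_{k+1}=n-1|Y'_k=n)=q_n$, $P(Y'_{k+1}=n+2|Y'_k=n)=p_n$. $D=\inf\{k\ge1:Y'_k<Y'_0\}$ (with $\inf\emptyset=\infty$) and $M=\sup\{Y'_k:0\le k\le D\}$. The notation $u_n\sim v_n$ means $u_n/v_n\to1$. *)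

theory Defs
  imports "HOL-Probability.Probability" "HOL-Library.Landau_Symbols" "HOL-Library.Extended_Nat"
begin

definition iter_log :: "nat \<Rightarrow> real \<Rightarrow> real" where
  "iter_log k x = (ln ^^ k) x"

(* For K = 1 the index set {..<K - 1} is empty, and the sum vanishes. *)
definition Lambda :: "nat \<Rightarrow> nat \<Rightarrow> real \<Rightarrow> real" where
  "Lambda K i B =
     (\<Sum>m<K - 1. 1 / (\<Prod>j\<le>m. iter_log j (real i))) + B / (\<Prod>j<K. iter_log j (real i))"

(* In HOL, ln is total, with ln x = ln \<bar>x\<bar> and ln 0 = 0.  The informal condition
   log_{K-1} i > 0 presupposes that log_{K-1} i is defined, i.e. that log_j i > 0 for all
   j < K - 1 as well; hence the quantifier over j < K. *)
definition first_index :: "nat \<Rightarrow> real \<Rightarrow> nat" where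
  "first_index K B =
     (LEAST i. 1 \<le> i \<and> (\<forall>j<K. 0 < iter_log j (real i)) \<and> \<bar>Lambda K i B\<bar> < 1)"

definition perturbation :: "nat \<Rightarrow> real \<Rightarrow> nat \<Rightarrow> real" where
  "perturbation K B i = Lambda K (max i (first_index K B)) B / 3"

definition step_prob_12 :: "(nat \<Rightarrow> real) \<Rightarrow> (nat \<Rightarrow> real) \<Rightarrow> nat \<Rightarrow> nat \<Rightarrow> real" where
  "step_prob_12 p q n m =
     (if n = 0 then (if m = 2 then 1 else 0)
      else if n = 1 then (if m = 0 then 1 else 0)
      else if m = n - 1 then q n
      else if m = n + 2 then p n
      else 0)"

(* The values of p and q at 0 and 1 are irrelevant.  The initial distribution is left free. *)
locale random_walk_12 = prob_space P
  for P :: "'a measure" +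
  fixes p q :: "nat \<Rightarrow> real" and Y :: "nat \<Rightarrow> 'a \<Rightarrow> nat"
  assumes p_pos: "2 \<le> n \<Longrightarrow> 0 < p n"
    and q_pos: "2 \<le> n \<Longrightarrow> 0 < q n"
    and q_plus_p: "2 \<le> n \<Longrightarrow> q n + p n = 1"
    and Y_measurable: "Y k \<in> measurable P (count_space UNIV)"
    and markov: "0 < \<P>(\<omega> in P. \<forall>j\<le>k. Y j \<omega> = y j) \<Longrightarrow>
      \<P>(\<omega> in P. Y (Suc k) \<omega> = m \<bar> \<forall>j\<le>k. Y j \<omega> = y j) = step_prob_12 p q (y k) m"

(* In enat, the infimum of the empty set is \<infinity>. *)
definition exit_time :: "(nat \<Rightarrow> 'a \<Rightarrow> nat) \<Rightarrow> 'a \<Rightarrow> enat" where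
  "exit_time Y \<omega> = (INF k \<in> {k. 1 \<le> k \<and> Y k \<omega> < Y 0 \<omega>}. enat k)"

definition excursion_max :: "(nat \<Rightarrow> 'a \<Rightarrow> nat) \<Rightarrow> 'a \<Rightarrow> enat" where
  "excursion_max Y \<omega> = (SUP k \<in> {k. enat k \<le> exit_time Y \<omega>}. enat (Y k \<omega>))"

definition excursion_max_prob :: "'a measure \<Rightarrow> (nat \<Rightarrow> 'a \<Rightarrow> nat) \<Rightarrow> nat \<Rightarrow> real" where
  "excursion_max_prob P Y n = \<P>(\<omega> in P. excursion_max Y \<omega> = enat n \<and> exit_time Y \<omega> < \<infinity>)"

end

theory Submission
  imports Defs "HOL-Real_Asymp.Real_Asymp"
begin

text \<open>
  Let \<open>f\<close> be the probability of reaching \<open>1\<close> before exceeding \<open>N\<close>. Harmonicity of \<open>f\<close> turns into the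
  recursion \<open>\<delta>\<^sub>k\<^sub>-\<^sub>1 = \<theta>\<^sub>k (\<delta>\<^sub>k + \<delta>\<^sub>k\<^sub>+\<^sub>1)\<close>, \<open>\<theta>\<^sub>k = p\<^sub>k / q\<^sub>k\<close>, for the differences \<open>\<delta>\<^sub>k = f k - f (k + 1)\<close>.
  Solved from the top it gives \<open>P(M \<le> N, D < \<infinity>) = 1 - A\<^sub>N / S\<^sub>N\<close>, where \<open>A\<^sub>N\<close> and \<open>S\<^sub>N\<close> satisfy forward
  recursions in \<open>N\<close> with positive coefficients:
  \<open>A\<^sub>N = \<theta>\<^sub>N A\<^sub>N\<^sub>-\<^sub>1 + \<theta>\<^sub>N\<^sub>-\<^sub>1 A\<^sub>N\<^sub>-\<^sub>2\<close> and \<open>S\<^sub>N = 1 + \<theta>\<^sub>N S\<^sub>N\<^sub>-\<^sub>1 + \<theta>\<^sub>N\<^sub>-\<^sub>1 S\<^sub>N\<^sub>-\<^sub>2\<close>.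
  With \<open>p\<^sub>i = (1 + \<lambda>\<^sub>i) / 3\<close> the quotient of \<open>A\<^sub>N\<close> by \<open>\<Prod>\<^sub>i\<^sub>\<le>\<^sub>N (1 + \<lambda>\<^sub>i)\<close> converges, because the normalised
  recursion is a summable perturbation of averaging two consecutive terms; hence \<open>A\<^sub>N \<sim> a exp (\<psi> N)\<close>
  for an antiderivative \<open>\<psi>\<close> of \<open>\<lambda>\<close>. The increments of \<open>t\<^sub>N = S\<^sub>N / A\<^sub>N\<close> are asymptotic to \<open>2 / (3 A\<^sub>N)\<close>, so
  \<open>P(M = N, D < \<infinity>) = 1 / t\<^sub>N\<^sub>-\<^sub>1 - 1 / t\<^sub>N\<close> is asymptotic to a multiple of \<open>exp (- \<psi> N) / \<Phi>(N)\<^sup>2\<close> if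
  \<open>\<Phi>' \<sim> exp (- \<psi>)\<close> with \<open>\<Phi> \<rightarrow> \<infinity>\<close>, and of \<open>exp (- \<psi> N)\<close> if \<open>\<Phi>\<close> stays bounded.
\<close>

section \<open>Second-order recursions\<close>

text \<open>\<open>path_weight \<theta> k (N - k)\<close> is \<open>(f k - f (k + 1)) / f N\<close> for the function \<open>f\<close> that is harmonic on
  \<open>{2..N}\<close> and vanishes above \<open>N\<close>; it satisfies a recursion in \<open>N\<close> (the definition) and the
  adjoint one in \<open>k\<close>.\<close>

fun path_weight :: "(nat \<Rightarrow> real) \<Rightarrow> nat \<Rightarrow> nat \<Rightarrow> real" where
  "path_weight \<theta> k 0 = 1"
| "path_weight \<theta> k (Suc 0) = \<theta> (Suc k)"
| "path_weight \<theta> k (Suc (Suc d)) =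
     \<theta> (k + d + 2) * path_weight \<theta> k (Suc d) + \<theta> (k + d + 1) * path_weight \<theta> k d"

text \<open>\<open>path_weight \<theta> k d\<close> sums over paths from \<open>k\<close> to
  \<open>k + d\<close> with steps of size 1 and 2, where a step leaving \<open>i\<close> has weight
  \<open>\<theta> (i + 1)\<close>. The definition splits off the last step; splitting off the first
  one gives this recursion.\<close>

lemma path_weight_backward:
  "path_weight \<theta> k (Suc (Suc d)) =
     \<theta> (Suc k) * (path_weight \<theta> (Suc k) (Suc d) + path_weight \<theta> (Suc (Suc k)) d)"
proof (induction d rule: induct_nat_012)
  case 0
  then show ?case by (simp add: algebra_simps)
next
  case 1
  then show ?case by (simp add: algebra_simps numeral_3_eq_3)
next
  case (ge2 d)
  have "path_weight \<theta> k (Suc (Suc (Suc (Suc d)))) =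
      \<theta> (k + d + 4) * path_weight \<theta> k (Suc (Suc (Suc d))) + \<theta> (k + d + 3) * path_weight \<theta> k (Suc (Suc d))"
    by (simp add: numeral_eq_Suc)
  also have "\<dots> = \<theta> (Suc k) * (path_weight \<theta> (Suc k) (Suc (Suc (Suc d))) + path_weight \<theta> (Suc (Suc k)) (Suc (Suc d)))"
    unfolding ge2 by (simp add: numeral_eq_Suc algebra_simps)
  finally show ?case .
qed

lemma path_weight_pos:
  assumes "\<And>i. 2 \<le> i \<Longrightarrow> 0 < \<theta> i" "1 \<le> k"
  shows "0 < path_weight \<theta> k d"
  using assms by (induction \<theta> k d rule: path_weight.induct) (auto intro!: add_pos_pos mult_pos_pos)

text \<open>The quantity \<open>S\<^sub>N\<close> for \<open>N = m + 1\<close>: the sum of all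
  differences from 1 up to the top, hence \<open>f 1\<close> in units of \<open>f N\<close>.\<close>

definition total_weight :: "(nat \<Rightarrow> real) \<Rightarrow> nat \<Rightarrow> real" where
  "total_weight \<theta> m = (\<Sum>k\<le>m. path_weight \<theta> (Suc k) (m - k))"

text \<open>The recursion defining \<open>path_weight\<close> applies to the starting points up to
  \<open>m + 1\<close>. The point \<open>m + 2\<close> contributes \<open>\<theta> (m + 3)\<close>,
  which completes the multiple of \<open>total_weight \<theta> (Suc m)\<close>, and
  \<open>m + 3\<close> contributes the extra 1.\<close>

lemma total_weight_rec:
  "total_weight \<theta> (Suc (Suc m)) =
     1 + \<theta> (m + 3) * total_weight \<theta> (Suc m) + \<theta> (m + 2) * total_weight \<theta> m"
proof -
  have "(\<Sum>k\<le>m. path_weight \<theta> (Suc k) (Suc (Suc m) - k)) =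
      (\<Sum>k\<le>m. \<theta> (m + 3) * path_weight \<theta> (Suc k) (Suc m - k) + \<theta> (m + 2) * path_weight \<theta> (Suc k) (m - k))"
  proof (rule sum.cong)
    fix k assume "k \<in> {..m}"
    then have "Suc (Suc m) - k = Suc (Suc (m - k))" "Suc m - k = Suc (m - k)"
      "Suc k + (m - k) + 2 = m + 3" "Suc k + (m - k) + 1 = m + 2" by auto
    then show "path_weight \<theta> (Suc k) (Suc (Suc m) - k) =
      \<theta> (m + 3) * path_weight \<theta> (Suc k) (Suc m - k) + \<theta> (m + 2) * path_weight \<theta> (Suc k) (m - k)"
      by (simp only: path_weight.simps)
  qed simp
  then show ?thesis
    by (simp add: total_weight_def sum.distrib sum_distrib_left algebra_simps numeral_eq_Suc)
qed

lemma total_weight_ge: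
  assumes "\<And>i. 2 \<le> i \<Longrightarrow> 0 < \<theta> i"
  shows "path_weight \<theta> 1 m \<le> total_weight \<theta> m"
proof -
  have "path_weight \<theta> (Suc 0) (m - 0) \<le> (\<Sum>k\<le>m. path_weight \<theta> (Suc k) (m - k))"
    by (rule member_le_sum) (auto intro!: less_imp_le path_weight_pos assms)
  then show ?thesis by (simp add: total_weight_def)
qed

text \<open>This Casoratian satisfies a first-order recursion, which makes the one-point probabilities
  accessible and not only the tail.\<close>

definition weight_cross :: "(nat \<Rightarrow> real) \<Rightarrow> nat \<Rightarrow> real" where
  "weight_cross \<theta> m =
     path_weight \<theta> 1 m * total_weight \<theta> (Suc m) - path_weight \<theta> 1 (Suc m) * total_weight \<theta> m"

text \<open>When both second-order recursions are inserted, the terms with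
  \<open>\<theta> (m + 3)\<close> cancel, and the inhomogeneous 1 leaves
  \<open>path_weight \<theta> 1 (Suc m)\<close>.\<close>

lemma weight_cross_rec:
  "weight_cross \<theta> (Suc m) = path_weight \<theta> 1 (Suc m) - \<theta> (m + 2) * weight_cross \<theta> m"
  by (simp add: weight_cross_def total_weight_rec algebra_simps numeral_eq_Suc)

section \<open>Contractions and averages with small perturbations\<close>

lemma tendsto_0_contraction:
  fixes v \<epsilon> :: "nat \<Rightarrow> real"
  assumes r: "0 \<le> r" "r < 1" and v: "\<And>m. 0 \<le> v m"
    and step: "\<forall>\<^sub>F m in sequentially. v (Suc m) \<le> r * v m + \<epsilon> m"
    and \<epsilon>: "\<epsilon> \<longlonglongrightarrow> 0"
  shows "v \<longlonglongrightarrow> 0"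
proof (rule LIMSEQ_I)
  fix e :: real assume e: "e > 0"
  have "\<forall>\<^sub>F m in sequentially. \<epsilon> m < (1 - r) * (e / 2)"
    using e r by (intro order_tendstoD(2)[OF \<epsilon>]) auto
  with step have "\<forall>\<^sub>F m in sequentially. v (Suc m) \<le> r * v m + (1 - r) * (e / 2)"
    by eventually_elim auto
  then obtain m0 where m0: "\<And>m. m \<ge> m0 \<Longrightarrow> v (Suc m) \<le> r * v m + (1 - r) * (e / 2)"
    by (auto simp: eventually_sequentially)
  \<comment> \<open>The perturbation \<open>(1 - r) * (e / 2)\<close> makes \<open>e / 2\<close> the
    fixed point of the affine bound, so iteration adds only a geometric term.\<close>
  have bound: "v (m0 + k) \<le> r ^ k * v m0 + e / 2" for k
  proof (induction k)
    case (Suc k)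
    have "v (m0 + Suc k) \<le> r * v (m0 + k) + (1 - r) * (e / 2)" using m0[of "m0 + k"] by simp
    also have "\<dots> \<le> r * (r ^ k * v m0 + e / 2) + (1 - r) * (e / 2)"
      using Suc r by (intro add_right_mono mult_left_mono)
    also have "\<dots> = r ^ Suc k * v m0 + e / 2" by (simp add: field_simps)
    finally show ?case .
  qed (use e in simp)
  have "(\<lambda>k. r ^ k * v m0) \<longlonglongrightarrow> 0 * v m0"
    using r by (intro tendsto_mult LIMSEQ_realpow_zero tendsto_const)
  then have "\<forall>\<^sub>F k in sequentially. r ^ k * v m0 < e / 2"
    using e by (intro order_tendstoD) auto
  then obtain k0 where k0: "\<And>k. k \<ge> k0 \<Longrightarrow> r ^ k * v m0 < e / 2"
    by (auto simp: eventually_sequentially)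
  have "norm (v n - 0) < e" if "n \<ge> m0 + k0" for n
  proof -
    have "k0 \<le> n - m0" "m0 + (n - m0) = n" using that by auto
    then show ?thesis using bound[of "n - m0"] k0[of "n - m0"] v[of n] by simp
  qed
  then show "\<exists>no. \<forall>n\<ge>no. norm (v n - 0) < e" by blast
qed

text \<open>Summing the inequality bounds \<open>(1 - r)\<close> times the partial sums of
  \<open>v\<close> by a boundary term and the sum of \<open>\<epsilon>\<close>.\<close>

lemma summable_contraction:
  fixes v \<epsilon> :: "nat \<Rightarrow> real"
  assumes r: "0 \<le> r" "r < 1" and v: "\<And>m. 0 \<le> v m"
    and step: "\<forall>\<^sub>F m in sequentially. v (Suc m) \<le> r * v m + \<epsilon> m"
    and \<epsilon>0: "\<And>m. 0 \<le> \<epsilon> m" and \<epsilon>: "summable \<epsilon>"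
  shows "summable v"
proof -
  obtain m0 where m0: "\<And>m. m \<ge> m0 \<Longrightarrow> v (Suc m) \<le> r * v m + \<epsilon> m"
    using step by (auto simp: eventually_sequentially)
  have \<epsilon>': "summable (\<lambda>k. \<epsilon> (k + m0))" using \<epsilon> summable_iff_shift[of \<epsilon> m0] by simp
  have bound: "(1 - r) * (\<Sum>k<n. v (k + m0)) \<le> v m0 + (\<Sum>k<n. \<epsilon> (k + m0)) - v (n + m0)" for n
  proof (induction n)
    case (Suc n)
    have "v (Suc n + m0) \<le> r * v (n + m0) + \<epsilon> (n + m0)" using m0[of "n + m0"] by simp
    then show ?case using Suc by (simp add: algebra_simps)
  qed simp
  have \<epsilon>_le: "(\<Sum>k<n. \<epsilon> (k + m0)) \<le> (\<Sum>k. \<epsilon> (k + m0))" for n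
    by (rule sum_le_suminf[OF \<epsilon>']) (auto simp: \<epsilon>0)
  have "(1 - r) * (\<Sum>k<n. v (k + m0)) \<le> v m0 + (\<Sum>k. \<epsilon> (k + m0))" for n
    using bound[of n] \<epsilon>_le[of n] v[of "n + m0"] by linarith
  then have "(\<Sum>k<n. v (k + m0)) \<le> (v m0 + (\<Sum>k. \<epsilon> (k + m0))) / (1 - r)" for n
    using r by (simp add: field_simps)
  then have "summable (\<lambda>k. v (k + m0))" by (intro summableI_nonneg_bounded v)
  then show ?thesis using summable_iff_shift[of v m0] by simp
qed

text \<open>Each new term is almost a weighted mean of the last two. The maximum of two consecutive
  terms grows at most by factors \<open>exp (e m)\<close>, so \<open>b\<close> is bounded; the
  differences then contract up to a summable error, so \<open>b\<close> converges; and a lower bound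
  on the minimum of two consecutive terms makes the limit positive.\<close>

lemma convergent_second_order_rec:
  fixes b \<alpha> \<beta> :: "nat \<Rightarrow> real"
  assumes rec: "\<And>m. b (Suc (Suc m)) = \<alpha> m * b (Suc m) + \<beta> m * b m"
    and b: "\<And>m. 0 < b m" and \<alpha>: "\<And>m. 0 < \<alpha> m" and \<beta>: "\<And>m. 0 < \<beta> m"
    and \<beta>_lim: "\<beta> \<longlonglongrightarrow> 1 / 2"
    and sum: "summable (\<lambda>m. \<bar>\<alpha> m + \<beta> m - 1\<bar>)"
  shows "\<exists>l>0. b \<longlonglongrightarrow> l"
proof -
  define e where "e m = \<bar>\<alpha> m + \<beta> m - 1\<bar>" for m
  have e0: "0 \<le> e m" for m by (simp add: e_def)
  have esum: "summable e" using sum by (simp add: e_def[abs_def])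
  define U where "U = max (b 0) (b 1) * exp (suminf e)"
  have up: "b m \<le> max (b 0) (b 1) * exp (\<Sum>i<m. e i) \<and> b (Suc m) \<le> max (b 0) (b 1) * exp (\<Sum>i<m. e i)" for m
  proof (induction m)
    case (Suc m)
    let ?X = "max (b 0) (b 1) * exp (\<Sum>i<m. e i)"
    have X: "?X > 0" using b[of 0] by (simp add: less_max_iff_disj)
    have "b (Suc (Suc m)) \<le> \<alpha> m * ?X + \<beta> m * ?X"
      unfolding rec using Suc \<alpha>[of m] \<beta>[of m] by (intro add_mono mult_left_mono) auto
    also have "\<dots> = (\<alpha> m + \<beta> m) * ?X" by (simp add: algebra_simps)
    also have "\<dots> \<le> exp (e m) * ?X"
    proof (rule mult_right_mono)
      have "\<alpha> m + \<beta> m \<le> 1 + e m" by (simp add: e_def)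
      also have "\<dots> \<le> exp (e m)" by (rule exp_ge_add_one_self)
      finally show "\<alpha> m + \<beta> m \<le> exp (e m)" .
    qed (use X in simp)
    finally have "b (Suc (Suc m)) \<le> exp (e m) * ?X" .
    also have eq: "exp (e m) * ?X = max (b 0) (b 1) * exp (\<Sum>i<Suc m. e i)" by (simp add: exp_add algebra_simps)
    finally have 1: "b (Suc (Suc m)) \<le> max (b 0) (b 1) * exp (\<Sum>i<Suc m. e i)" .
    have "1 * ?X \<le> exp (e m) * ?X" using X e0[of m] by (intro mult_right_mono) auto
    then have "?X \<le> max (b 0) (b 1) * exp (\<Sum>i<Suc m. e i)" unfolding eq by simp
    with Suc 1 show ?case by linarith
  qed auto
  have bU: "b m \<le> U" for m
  proof -
    have "(\<Sum>i<m. e i) \<le> suminf e" by (rule sum_le_suminf[OF esum]) (auto simp: e0)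
    then have "max (b 0) (b 1) * exp (\<Sum>i<m. e i) \<le> U"
      unfolding U_def using b[of 0] by (intro mult_left_mono) auto
    with up[of m] show ?thesis by linarith
  qed
  have U: "U \<ge> 0" using b[of 0] bU[of 0] by linarith
  have "\<forall>\<^sub>F m in sequentially. \<beta> m < 3 / 4" by (rule order_tendstoD[OF \<beta>_lim]) simp
  then have "\<forall>\<^sub>F m in sequentially. \<bar>b (Suc (Suc m)) - b (Suc m)\<bar> \<le> 3 / 4 * \<bar>b (Suc m) - b m\<bar> + U * e m"
  proof eventually_elim
    case (elim m)
    \<comment> \<open>An exact mean multiplies the difference by \<open>- \<beta> m\<close>, which
      is close to -1/2; the rest is the defect of the weights.\<close>
    have "b (Suc (Suc m)) - b (Suc m) = (\<alpha> m + \<beta> m - 1) * b (Suc m) - \<beta> m * (b (Suc m) - b m)"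
      by (simp add: rec algebra_simps)
    also have "\<bar>\<dots>\<bar> \<le> e m * b (Suc m) + \<beta> m * \<bar>b (Suc m) - b m\<bar>"
      using \<beta>[of m] b[of "Suc m"]
      by (intro order_trans[OF abs_triangle_ineq4]) (simp add: abs_mult e_def)
    also have "\<dots> \<le> e m * U + 3 / 4 * \<bar>b (Suc m) - b m\<bar>"
      using elim bU e0 less_imp_le[OF b] by (intro add_mono mult_mono) auto
    finally show ?case by (simp add: algebra_simps)
  qed
  then have "summable (\<lambda>m. \<bar>b (Suc m) - b m\<bar>)"
    by (rule summable_contraction[where r = "3/4" and \<epsilon> = "\<lambda>m. U * e m", rotated 3])
      (use U e0 esum in \<open>auto intro: summable_mult\<close>)
  then have "summable (\<lambda>m. b (Suc m) - b m)" by (rule summable_rabs_cancel)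
  then have "convergent (\<lambda>n. \<Sum>m<n. b (Suc m) - b m)" by (simp add: summable_iff_convergent)
  then have "convergent (\<lambda>n. (b n - b 0) + b 0)"
    by (subst (asm) sum_lessThan_telescope) (intro convergent_add convergent_const)
  then obtain l where l: "b \<longlonglongrightarrow> l" by (auto simp: convergent_def)
  have "(\<lambda>m0. \<Sum>i. e (i + m0)) \<longlonglongrightarrow> 0" using esum by (rule suminf_exist_split2)
  then have "\<forall>\<^sub>F m0 in sequentially. (\<Sum>i. e (i + m0)) < 1 / 2" by (rule order_tendstoD) simp
  \<comment> \<open>From \<open>m0\<close> on the total defect is below 1/2, so the lower bounds
    lose at most half of \<open>\<mu>\<close>.\<close>
  then obtain m0 where m0: "(\<Sum>i. e (i + m0)) < 1 / 2" by (auto simp: eventually_sequentially)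
  define \<mu> where "\<mu> = min (b m0) (b (Suc m0))"
  have \<mu>: "\<mu> > 0" using b by (simp add: \<mu>_def)
  have esum': "summable (\<lambda>i. e (i + m0))" using esum summable_iff_shift[of e m0] by simp
  have s: "(\<Sum>i<k. e (i + m0)) < 1 / 2" for k
    using sum_le_suminf[OF esum', of "{..<k}"] e0 m0 by force
  have low: "\<mu> * (1 - (\<Sum>i<k. e (i + m0))) \<le> b (k + m0) \<and> \<mu> * (1 - (\<Sum>i<k. e (i + m0))) \<le> b (Suc k + m0)" for k
  proof (induction k)
    case (Suc k)
    define s where "s = (\<Sum>i<k. e (i + m0))"
    have s01: "0 \<le> s" "s < 1 / 2" "s + e (k + m0) < 1 / 2"
      using s[of k] s[of "Suc k"] e0 by (auto simp: s_def intro!: sum_nonneg)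
    let ?X = "\<mu> * (1 - s)"
    have X: "?X > 0" using s01 \<mu> by simp
    have "(1 - e (k + m0)) * ?X \<le> (\<alpha> (k + m0) + \<beta> (k + m0)) * ?X"
      using X by (intro mult_right_mono) (auto simp: e_def)
    also have "\<dots> = \<alpha> (k + m0) * ?X + \<beta> (k + m0) * ?X" by (simp add: algebra_simps)
    also have "\<dots> \<le> b (Suc (Suc (k + m0)))"
      unfolding rec using Suc \<alpha>[of "k + m0"] \<beta>[of "k + m0"] by (intro add_mono mult_left_mono) (auto simp: s_def)
    finally have 1: "(1 - e (k + m0)) * ?X \<le> b (Suc (Suc k) + m0)" by simp
    have "\<mu> * (1 - (s + e (k + m0))) \<le> \<mu> * (1 - s) * (1 - e (k + m0))"
      using \<mu> s01 e0[of "k + m0"] by (simp add: algebra_simps)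
    with 1 have 2: "\<mu> * (1 - (s + e (k + m0))) \<le> b (Suc (Suc k) + m0)" by (simp add: mult_ac)
    have "\<mu> * (1 - (s + e (k + m0))) \<le> ?X" using \<mu> e0[of "k + m0"] by (intro mult_left_mono) auto
    with Suc 2 show ?case by (auto simp: s_def)
  qed (auto simp: \<mu>_def)
  have "\<mu> / 2 \<le> b (k + m0)" for k
  proof -
    have "\<mu> * (1 / 2) \<le> \<mu> * (1 - (\<Sum>i<k. e (i + m0)))" using s[of k] \<mu> by (intro mult_left_mono) auto
    with low[of k] show ?thesis by simp
  qed
  then have "\<mu> / 2 \<le> l"
    by (intro LIMSEQ_le_const[OF LIMSEQ_ignore_initial_segment[OF l, of m0]]) auto
  with \<mu> l show ?thesis by (intro exI[of _ l]) auto
qed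

text \<open>The increments of \<open>t - c * \<Phi>\<close> are in absolute value at most
  \<open>e / 2\<close> times those of \<open>\<Phi>\<close>; they are summed from \<open>n0\<close>
  on and divided by \<open>\<Phi>\<close>, which tends to infinity.\<close>

lemma stolz_cesaro:
  fixes t \<Phi> :: "nat \<Rightarrow> real"
  assumes inc: "\<forall>\<^sub>F n in sequentially. \<Phi> n < \<Phi> (Suc n)"
    and top: "filterlim \<Phi> at_top sequentially"
    and lim: "(\<lambda>n. (t (Suc n) - t n) / (\<Phi> (Suc n) - \<Phi> n)) \<longlonglongrightarrow> c"
  shows "(\<lambda>n. t n / \<Phi> n) \<longlonglongrightarrow> c"
proof (rule tendstoI)
  fix e :: real assume e: "e > 0"
  have "\<forall>\<^sub>F n in sequentially. dist ((t (Suc n) - t n) / (\<Phi> (Suc n) - \<Phi> n)) c < e / 2"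
    using lim e by (intro tendstoD) auto
  with inc have "\<forall>\<^sub>F n in sequentially. \<bar>(t (Suc n) - c * \<Phi> (Suc n)) - (t n - c * \<Phi> n)\<bar> \<le> e / 2 * (\<Phi> (Suc n) - \<Phi> n)"
  proof eventually_elim
    case (elim n)
    then have d: "\<Phi> (Suc n) - \<Phi> n > 0" by simp
    have "(t (Suc n) - c * \<Phi> (Suc n)) - (t n - c * \<Phi> n) = ((t (Suc n) - t n) / (\<Phi> (Suc n) - \<Phi> n) - c) * (\<Phi> (Suc n) - \<Phi> n)"
      using d by (simp add: field_simps)
    also have "\<bar>\<dots>\<bar> \<le> e / 2 * (\<Phi> (Suc n) - \<Phi> n)"
      using elim d e unfolding abs_mult dist_real_def by (intro mult_mono) auto
    finally show ?case .
  qed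
  then obtain n0 where n0: "\<And>n. n \<ge> n0 \<Longrightarrow> \<bar>(t (Suc n) - c * \<Phi> (Suc n)) - (t n - c * \<Phi> n)\<bar> \<le> e / 2 * (\<Phi> (Suc n) - \<Phi> n)"
    by (auto simp: eventually_sequentially)
  \<comment> \<open>\<open>R\<close> collects all that depends on \<open>n0\<close>; once
    \<open>\<Phi> n\<close> exceeds \<open>2 * R / e\<close>, it costs less than a second
    \<open>e / 2 * \<Phi> n\<close>.\<close>
  define R where "R = \<bar>t n0 - c * \<Phi> n0\<bar> + e / 2 * \<bar>\<Phi> n0\<bar>"
  have bound: "\<bar>t n - c * \<Phi> n\<bar> \<le> \<bar>t n0 - c * \<Phi> n0\<bar> + e / 2 * (\<Phi> n - \<Phi> n0)" if "n \<ge> n0" for n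
    using that
  proof (induction n rule: dec_induct)
    case (step n)
    have "e / 2 * (\<Phi> (Suc n) - \<Phi> n0) = e / 2 * (\<Phi> (Suc n) - \<Phi> n) + e / 2 * (\<Phi> n - \<Phi> n0)"
      by (simp add: field_simps)
    then show ?case using n0[of n] step by linarith
  qed simp
  have "\<forall>\<^sub>F n in sequentially. \<Phi> n > max 0 (2 * R / e)"
    by (rule filterlim_at_top_dense[THEN iffD1, rule_format, OF top])
  then show "\<forall>\<^sub>F n in sequentially. dist (t n / \<Phi> n) c < e"
    using eventually_ge_at_top[of n0]
  proof eventually_elim
    case (elim n)
    then have \<Phi>: "\<Phi> n > 0" "R < e / 2 * \<Phi> n" using e by (auto simp: field_simps)
    have "e / 2 * (\<Phi> n - \<Phi> n0) \<le> e / 2 * (\<Phi> n + \<bar>\<Phi> n0\<bar>)"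
      using e by (intro mult_left_mono) auto
    then have "e / 2 * (\<Phi> n - \<Phi> n0) \<le> e / 2 * \<Phi> n + e / 2 * \<bar>\<Phi> n0\<bar>"
      by (simp only: distrib_left)
    then have "\<bar>t n - c * \<Phi> n\<bar> < e * \<Phi> n"
      using bound[of n] elim \<Phi> unfolding R_def by linarith
    moreover have "t n / \<Phi> n - c = (t n - c * \<Phi> n) / \<Phi> n" using \<Phi> by (simp add: field_simps)
    ultimately show ?case using \<Phi> by (simp add: dist_real_def field_simps)
  qed
qed

section \<open>Weights under a slowly varying drift\<close>

lemma summable_telescope_antimono:
  fixes G :: "real \<Rightarrow> real"
  assumes anti: "\<And>x y. X0 \<le> x \<Longrightarrow> x \<le> y \<Longrightarrow> G y \<le> G x"
    and nonneg: "\<And>x. X0 \<le> x \<Longrightarrow> 0 \<le> G x"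
  shows "summable (\<lambda>n. G (real n) - G (real (Suc n)))"
proof -
  obtain n0 :: nat where n0: "X0 \<le> real n0" using real_arch_simple by blast
  have "summable (\<lambda>n. G (real (n + n0)) - G (real (Suc (n + n0))))"
  proof (rule summableI_nonneg_bounded[where x = "G (real n0)"])
    fix n
    show "0 \<le> G (real (n + n0)) - G (real (Suc (n + n0)))"
      using anti[of "real (n + n0)" "real (Suc (n + n0))"] n0 by simp
    have "(\<Sum>i<n. G (real (i + n0)) - G (real (Suc (i + n0)))) = G (real n0) - G (real (n + n0))"
      by (induction n) auto
    then show "(\<Sum>i<n. G (real (i + n0)) - G (real (Suc (i + n0)))) \<le> G (real n0)"
      using nonneg[of "real (n + n0)"] n0 by simp
  qed
  then show ?thesis
    using summable_iff_shift[of "\<lambda>n. G (real n) - G (real (Suc n))" n0] by simp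
qed

lemma eventually_real_ge: "\<forall>\<^sub>F n in sequentially. X \<le> real n"
  by (rule filterlim_at_top[THEN iffD1, rule_format, OF filterlim_real_sequentially])

lemma mult_exp_cancel: "a * exp (- u) * (d * exp u) = a * d" for a d u :: real
  by (simp add: exp_minus)

text \<open>The probability of the maximum \<open>m + 2\<close> is expressed by weights with index
  \<open>m\<close>; this absorbs the shift.\<close>

lemma asymp_equiv_shift2I:
  fixes f g :: "nat \<Rightarrow> real"
  assumes "\<forall>\<^sub>F n in sequentially. g n \<noteq> 0" and "(\<lambda>m. f (m + 2) / g (m + 2)) \<longlonglongrightarrow> c" and "c > 0"
  shows "\<exists>c>0. f \<sim>[at_top] (\<lambda>n. c * g n)"
proof -
  have "(\<lambda>n. f n / g n) \<longlonglongrightarrow> c" using assms(2) by (rule LIMSEQ_offset)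
  then have "(\<lambda>n. f n / g n / c) \<longlonglongrightarrow> c / c" using assms(3) by (intro tendsto_intros) auto
  then have "(\<lambda>n. f n / (c * g n)) \<longlonglongrightarrow> 1" using assms(3) by (simp add: mult.commute)
  then show ?thesis using assms(3) by (intro exI[of _ c] conjI asymp_equivI') auto
qed

lemma asymp_equiv_divideI:
  fixes f g h :: "nat \<Rightarrow> real"
  assumes "\<exists>c>0. f \<sim>[at_top] (\<lambda>n. c * g n)" "0 < k" "\<forall>\<^sub>F n in sequentially. g n = k / h n"
  shows "\<exists>c>0. f \<sim>[at_top] (\<lambda>n. c / h n)"
proof -
  obtain c where c: "c > 0" "f \<sim>[at_top] (\<lambda>n. c * g n)" using assms(1) by blast
  have "\<forall>\<^sub>F n in sequentially. c * g n = c * k / h n" using assms(3) by eventually_elim simp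
  from iffD1[OF asymp_equiv_cong[OF always_eventually[OF allI[OF refl]] this] c(2)]
  have "f \<sim>[at_top] (\<lambda>n. c * k / h n)" .
  then show ?thesis using c(1) assms(2) by (intro exI[of _ "c * k"]) simp
qed

text \<open>The walk has \<open>p\<^sub>i = (1 + drift i) / 3\<close>, and \<open>\<psi>\<close> is an antiderivative of the drift, so that
  \<open>exp (- \<psi>)\<close> plays the role of the derivative of the scale function of a diffusion.\<close>

locale perturbed_weights =
  fixes \<theta> drift :: "nat \<Rightarrow> real" and \<psi> l G :: "real \<Rightarrow> real" and X0 C :: real
  assumes \<theta>: "\<And>i. 2 \<le> i \<Longrightarrow> \<theta> i = (1 + drift i) / (2 - drift i)"
    and drift_gt: "\<And>i. 2 \<le> i \<Longrightarrow> -1 < drift i" and drift_less: "\<And>i. 2 \<le> i \<Longrightarrow> drift i < 2"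
    and drift_eq: "\<forall>\<^sub>F i in sequentially. drift i = l (real i)"
    and X0: "0 < X0"
    and \<psi>: "\<And>x. X0 \<le> x \<Longrightarrow> (\<psi> has_real_derivative l x) (at x)"
    and l_osc: "\<And>x y. X0 \<le> x \<Longrightarrow> x \<le> y \<Longrightarrow> \<bar>l x - l y\<bar> \<le> G x - G y"
    and l_bound: "\<And>x. X0 \<le> x \<Longrightarrow> \<bar>l x\<bar> \<le> C / x"
    and G_nonneg: "\<And>x. X0 \<le> x \<Longrightarrow> 0 \<le> G x"
begin

abbreviation A :: "nat \<Rightarrow> real" where "A \<equiv> path_weight \<theta> 1"

text \<open>The quantity \<open>t\<^sub>N\<close> for \<open>N = m + 1\<close>. For the walk its
  reciprocal is the probability of exceeding \<open>N\<close> before dropping below the start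
  2.\<close>

definition mass_ratio :: "nat \<Rightarrow> real" where
  "mass_ratio m = total_weight \<theta> m / A m"

definition rel_cross :: "nat \<Rightarrow> real" where
  "rel_cross m = weight_cross \<theta> m / A m"

lemma \<theta>_pos: "2 \<le> i \<Longrightarrow> 0 < \<theta> i"
  using \<theta>[of i] drift_gt[of i] drift_less[of i] by simp

lemma A_pos: "0 < A m"
  by (intro path_weight_pos \<theta>_pos) auto

lemma G_antimono: "X0 \<le> x \<Longrightarrow> x \<le> y \<Longrightarrow> G y \<le> G x"
  using l_osc[of x y] by linarith

text \<open>This is the purpose of \<open>G\<close>: it dominates the oscillation of
  \<open>l\<close> between consecutive integers by a convergent telescoping series.\<close>

lemma G_summable: "summable (\<lambda>n. G (real n) - G (real (Suc n)))"
  by (rule summable_telescope_antimono) (auto intro: G_antimono G_nonneg)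

lemma drift_tendsto: "drift \<longlonglongrightarrow> 0"
proof (rule Lim_null_comparison)
  show "\<forall>\<^sub>F i in sequentially. norm (drift i) \<le> C / real i"
    using drift_eq eventually_real_ge[of X0] by eventually_elim (use l_bound in auto)
  show "(\<lambda>i. C / real i) \<longlonglongrightarrow> 0" by (rule lim_const_over_n)
qed

lemma drift_square_summable: "summable (\<lambda>i. (drift i)\<^sup>2)"
proof (rule summable_comparison_test_ev)
  show "\<forall>\<^sub>F i in sequentially. norm ((drift i)\<^sup>2) \<le> C\<^sup>2 * inverse (real i ^ 2)"
    using drift_eq eventually_real_ge[of X0]
  proof eventually_elim
    case (elim i)
    then have "(drift i)\<^sup>2 \<le> (C / real i)\<^sup>2"
      using l_bound[of "real i"] by (intro power2_le_iff_abs_le[THEN iffD2]) auto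
    then show ?case by (simp add: power_mult_distrib divide_inverse power_inverse)
  qed
  show "summable (\<lambda>i. C\<^sup>2 * inverse (real i ^ 2))"
    by (intro summable_mult inverse_power_summable) auto
qed

lemma drift_diff_summable: "summable (\<lambda>i. \<bar>drift (Suc i) - drift i\<bar>)"
proof (rule summable_comparison_test_ev[OF _ G_summable])
  have "\<forall>\<^sub>F i in sequentially. drift (Suc i) = l (real (Suc i))"
    using eventually_sequentially_Suc[of "\<lambda>i. drift i = l (real i)"] drift_eq by blast
  with drift_eq show "\<forall>\<^sub>F i in sequentially. norm \<bar>drift (Suc i) - drift i\<bar> \<le> G (real i) - G (real (Suc i))"
    using eventually_real_ge[of X0]
  proof eventually_elim
    case (elim i)
    then show ?case using l_osc[of "real i" "real (Suc i)"] by (simp add: abs_minus_commute)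
  qed
qed

section \<open>Asymptotics of the weights \<open>A\<close>\<close>

definition growth :: "nat \<Rightarrow> real" where "growth m = (\<Prod>j<m. 1 + drift (j + 2))"

lemma growth_pos: "0 < growth m"
  unfolding growth_def
proof (rule prod_pos)
  fix j show "0 < 1 + drift (j + 2)" using drift_gt[of "j + 2"] by simp
qed

text \<open>After division by \<^term>\<open>growth\<close> the two coefficients of the recursion add up to
  \<open>1 + ((y - x) + x\<^sup>2 (2 - y)) / ((2 - x) (2 - y) (1 + x))\<close> with \<open>x\<close>, \<open>y\<close> consecutive drifts,
  which is a summable perturbation of \<open>1\<close>.\<close>

lemma A_over_growth: "\<exists>a>0. (\<lambda>m. A m / growth m) \<longlonglongrightarrow> a"
proof (rule convergent_second_order_rec)
  define \<alpha> where "\<alpha> m = 1 / (2 - drift (m + 3))" for m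
  define \<beta> where "\<beta> m = 1 / ((2 - drift (m + 2)) * (1 + drift (m + 3)))" for m
  fix m
  have pos: "0 < 1 + drift (m + 2)" "0 < 1 + drift (m + 3)" "0 < 2 - drift (m + 2)" "0 < 2 - drift (m + 3)" for m
    using drift_gt[of "m + 2"] drift_gt[of "m + 3"] drift_less[of "m + 2"] drift_less[of "m + 3"] by auto
  show "0 < A m / growth m" using A_pos growth_pos by simp
  show "0 < \<alpha> m" "0 < \<beta> m" using pos by (simp_all add: \<alpha>_def \<beta>_def)
  have normalise: "(u / d * P + v / e * Q) / (g * v * u) = 1 / d * (P / (g * v)) + 1 / (e * u) * (Q / g)"
    if "0 < u" "0 < v" "0 < d" "0 < e" "0 < g" for u v d e g P Q :: real
    using that by (simp add: field_simps)
  have g: "growth (Suc (Suc m)) = growth m * (1 + drift (m + 2)) * (1 + drift (m + 3))"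
    "growth (Suc m) = growth m * (1 + drift (m + 2))"
    by (simp_all add: growth_def numeral_eq_Suc)
  have "A (Suc (Suc m)) = \<theta> (m + 3) * A (Suc m) + \<theta> (m + 2) * A m"
    by (simp add: numeral_eq_Suc)
  also have "\<theta> (m + 3) = (1 + drift (m + 3)) / (2 - drift (m + 3))" by (rule \<theta>) simp
  also have "\<theta> (m + 2) = (1 + drift (m + 2)) / (2 - drift (m + 2))" by (rule \<theta>) simp
  finally have A: "A (Suc (Suc m)) = (1 + drift (m + 3)) / (2 - drift (m + 3)) * A (Suc m)
     + (1 + drift (m + 2)) / (2 - drift (m + 2)) * A m" .
  show "A (Suc (Suc m)) / growth (Suc (Suc m)) =
    \<alpha> m * (A (Suc m) / growth (Suc m)) + \<beta> m * (A m / growth m)"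
    unfolding A g \<alpha>_def \<beta>_def using pos[of m] growth_pos[of m] by (intro normalise) auto
  have lim: "(\<lambda>m. drift (m + k)) \<longlonglongrightarrow> 0" for k
    by (rule LIMSEQ_ignore_initial_segment[OF drift_tendsto])
  have "\<beta> \<longlonglongrightarrow> 1 / ((2 - 0) * (1 + 0))"
    unfolding \<beta>_def by (intro tendsto_intros lim) auto
  then show "\<beta> \<longlonglongrightarrow> 1 / 2" by simp
  show "summable (\<lambda>m. \<bar>\<alpha> m + \<beta> m - 1\<bar>)"
  proof (rule summable_comparison_test_ev)
    have s: "summable (\<lambda>m. f (m + k))" if "summable f" for f :: "nat \<Rightarrow> real" and k
      using that summable_iff_shift by blast
    show "summable (\<lambda>m. \<bar>drift (Suc (m + 2)) - drift (m + 2)\<bar> + 3 * (drift (m + 3))\<^sup>2)"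
      by (intro summable_add summable_mult s[OF drift_diff_summable] s[OF drift_square_summable])
    have "\<forall>\<^sub>F m in sequentially. \<bar>drift (m + k)\<bar> < 1 / 4" for k
      using tendsto_rabs_zero[OF lim[of k]] by (rule order_tendstoD) simp
    from this[of 2] this[of 3]
    show "\<forall>\<^sub>F m in sequentially. norm \<bar>\<alpha> m + \<beta> m - 1\<bar> \<le>
      \<bar>drift (Suc (m + 2)) - drift (m + 2)\<bar> + 3 * (drift (m + 3))\<^sup>2"
    proof eventually_elim
      case (elim m)
      define x y where "x = drift (m + 3)" "y = drift (m + 2)"
      have x: "\<bar>x\<bar> < 1 / 4" "\<bar>y\<bar> < 1 / 4" using elim by (auto simp: x_y_def)
      have ge: "1 \<le> (2 - x) * (2 - y) * (1 + x)"
      proof -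
        have "(7/4) * (7/4) * (3/4) \<le> (2 - x) * (2 - y) * (1 + x)"
          using x by (intro mult_mono) auto
        then show ?thesis by simp
      qed
      have "\<alpha> m + \<beta> m - 1 = ((y - x) + x\<^sup>2 * (2 - y)) / ((2 - x) * (2 - y) * (1 + x))"
      proof -
        have "x \<noteq> 2" "y \<noteq> 2" "1 + x \<noteq> 0" using x by auto
        then show ?thesis
          unfolding \<alpha>_def \<beta>_def x_y_def[symmetric]
          by (simp add: divide_simps) (simp add: algebra_simps power2_eq_square)
      qed
      then have "\<bar>\<alpha> m + \<beta> m - 1\<bar> = \<bar>(y - x) + x\<^sup>2 * (2 - y)\<bar> / ((2 - x) * (2 - y) * (1 + x))"
        using ge by (simp add: abs_divide)
      also have "\<dots> \<le> \<bar>(y - x) + x\<^sup>2 * (2 - y)\<bar> / 1"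
        using ge by (intro divide_left_mono) auto
      also have "\<dots> \<le> \<bar>y - x\<bar> + x\<^sup>2 * 3"
        using x by (auto intro!: order_trans[OF abs_triangle_ineq] mult_left_mono simp: abs_mult)
      finally show ?case by (simp add: x_y_def numeral_eq_Suc)
    qed
  qed
qed

lemma \<psi>_increment:
  assumes "X0 \<le> x" "x < y"
  obtains \<xi> where "x < \<xi>" "\<xi> < y" "\<psi> y - \<psi> x = (y - x) * l \<xi>"
  using MVT2[of x y \<psi> l] assms \<psi> by fastforce

text \<open>The logarithm of \<open>growth\<close> sums \<open>ln (1 + drift)\<close>, while the
  increments of \<open>\<psi>\<close> are values \<open>l \<xi>\<close>. The differences
  \<open>\<epsilon>\<close> are bounded by a multiple of the squared drift and an oscillation of
  \<open>l\<close> over one unit, both summable.\<close>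

lemma growth_asymp: "\<exists>b>0. (\<lambda>m. growth m * exp (- \<psi> (real (m + 1)))) \<longlonglongrightarrow> b"
proof -
  define \<epsilon> where "\<epsilon> j = ln (1 + drift (j + 2)) - (\<psi> (real (j + 2)) - \<psi> (real (j + 1)))" for j
  \<comment> \<open>\<open>\<psi> 1\<close> is only the constant left by telescoping; the point 1
    may lie below \<open>X0\<close>, where nothing is assumed about \<open>\<psi>\<close>.\<close>
  have eq: "growth m * exp (- \<psi> (real (m + 1))) = exp ((\<Sum>j<m. \<epsilon> j) - \<psi> 1)" for m
  proof -
    have "ln (growth m) = (\<Sum>j<m. ln (1 + drift (j + 2)))"
      unfolding growth_def
    proof (rule ln_prod)
      fix j show "1 + drift (j + 2) \<noteq> 0" using drift_gt[of "j + 2"] by simp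
    qed simp
    moreover have "(\<Sum>j<m. \<psi> (real (j + 2)) - \<psi> (real (j + 1))) = \<psi> (real (m + 1)) - \<psi> 1"
      by (induction m) (auto simp: add_ac)
    ultimately have "(\<Sum>j<m. \<epsilon> j) - \<psi> 1 = ln (growth m) - \<psi> (real (m + 1))"
      unfolding \<epsilon>_def sum_subtractf by simp
    then show ?thesis using growth_pos[of m] by (simp add: exp_diff exp_minus divide_inverse)
  qed
  have "summable \<epsilon>"
  proof (rule summable_comparison_test_ev)
    have s: "summable (\<lambda>m. f (m + k))" if "summable f" for f :: "nat \<Rightarrow> real" and k
      using that summable_iff_shift by blast
    show "summable (\<lambda>j. 2 * (drift (j + 2))\<^sup>2 + (G (real (j + 1)) - G (real (Suc (j + 1)))))"
      by (intro summable_add summable_mult s[OF G_summable] s[OF drift_square_summable])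
    have "\<forall>\<^sub>F m in sequentially. \<bar>drift (m + 2)\<bar> < 1 / 2"
      using tendsto_rabs_zero[OF LIMSEQ_ignore_initial_segment[OF drift_tendsto, of 2]]
      by (rule order_tendstoD) simp
    moreover have "\<forall>\<^sub>F m in sequentially. drift (m + 2) = l (real (m + 2))"
      using drift_eq eventually_sequentially_seg[of "\<lambda>m. drift m = l (real m)" 2] by simp
    ultimately show "\<forall>\<^sub>F j in sequentially. norm (\<epsilon> j) \<le>
        2 * (drift (j + 2))\<^sup>2 + (G (real (j + 1)) - G (real (Suc (j + 1))))"
      using eventually_real_ge[of X0]
    proof eventually_elim
      case (elim j)
      obtain \<xi> where \<xi>: "real (j + 1) < \<xi>" "\<xi> < real (j + 2)"
        "\<psi> (real (j + 2)) - \<psi> (real (j + 1)) = (real (j + 2) - real (j + 1)) * l \<xi>"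
        using \<psi>_increment[of "real (j + 1)" "real (j + 2)"] elim by auto
      have "\<bar>l \<xi> - l (real (j + 2))\<bar> \<le> G \<xi> - G (real (j + 2))"
        using \<xi> elim by (intro l_osc) auto
      also have "G \<xi> \<le> G (real (j + 1))" using \<xi> elim by (intro G_antimono) auto
      finally have 1: "\<bar>l \<xi> - l (real (j + 2))\<bar> \<le> G (real (j + 1)) - G (real (j + 2))" by simp
      have 2: "\<bar>ln (1 + drift (j + 2)) - drift (j + 2)\<bar> \<le> 2 * (drift (j + 2))\<^sup>2"
        using elim by (intro abs_ln_one_plus_x_minus_x_bound) auto
      have "\<epsilon> j = (ln (1 + drift (j + 2)) - drift (j + 2)) - (l \<xi> - l (real (j + 2)))"
        using \<xi>(3) elim(2) by (simp add: \<epsilon>_def)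
      with 1 2 show ?case by simp
    qed
  qed
  then have "(\<lambda>m. exp ((\<Sum>j<m. \<epsilon> j) - \<psi> 1)) \<longlonglongrightarrow> exp (suminf \<epsilon> - \<psi> 1)"
    by (intro tendsto_intros summable_LIMSEQ)
  then show ?thesis unfolding eq by (intro exI[of _ "exp (suminf \<epsilon> - \<psi> 1)"]) auto
qed

lemma A_asymp: "\<exists>a>0. (\<lambda>m. A m * exp (- \<psi> (real (m + 1)))) \<longlonglongrightarrow> a"
proof -
  obtain a b where a: "a > 0" "(\<lambda>m. A m / growth m) \<longlonglongrightarrow> a"
    and b: "b > 0" "(\<lambda>m. growth m * exp (- \<psi> (real (m + 1)))) \<longlonglongrightarrow> b"
    using A_over_growth growth_asymp by blast
  have "(\<lambda>m. A m / growth m * (growth m * exp (- \<psi> (real (m + 1))))) \<longlonglongrightarrow> a * b"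
    by (intro tendsto_mult a b)
  moreover have "A m / growth m * (growth m * exp (- \<psi> (real (m + 1)))) = A m * exp (- \<psi> (real (m + 1)))" for m
    using growth_pos[of m] by simp
  ultimately show ?thesis using a b by (intro exI[of _ "a * b"]) auto
qed

text \<open>Since \<open>l\<close> is of order \<open>1 / x\<close>, moving the argument of
  \<open>\<psi>\<close> by at most 1 changes \<open>exp \<psi>\<close> only by a factor tending to
  1.\<close>

lemma \<psi>_diff_tendsto:
  fixes u v :: "nat \<Rightarrow> real"
  assumes "\<forall>\<^sub>F m in sequentially. real m \<le> u m \<and> u m < v m \<and> v m \<le> u m + 1"
  shows "(\<lambda>m. \<psi> (v m) - \<psi> (u m)) \<longlonglongrightarrow> 0"
proof (rule Lim_null_comparison)
  show "(\<lambda>m. C / real m) \<longlonglongrightarrow> 0" by (rule lim_const_over_n)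
  have C: "0 \<le> C"
    using order_trans[OF abs_ge_zero l_bound[of X0]] X0 by (simp add: zero_le_divide_iff)
  show "\<forall>\<^sub>F m in sequentially. norm (\<psi> (v m) - \<psi> (u m)) \<le> C / real m"
    using assms eventually_real_ge[of X0]
  proof eventually_elim
    case (elim m)
    obtain \<xi> where \<xi>: "u m < \<xi>" "\<xi> < v m" "\<psi> (v m) - \<psi> (u m) = (v m - u m) * l \<xi>"
      using \<psi>_increment[of "u m" "v m"] elim by auto
    have "\<bar>\<psi> (v m) - \<psi> (u m)\<bar> \<le> 1 * \<bar>l \<xi>\<bar>"
      unfolding \<xi>(3) abs_mult using elim by (intro mult_right_mono) auto
    also have "\<dots> \<le> C / \<xi>" using l_bound[of \<xi>] \<xi> elim by auto
    also have "\<dots> \<le> C / real m" using \<xi> elim X0 C by (intro divide_left_mono) auto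
    finally show ?case by simp
  qed
qed

lemma A_ratio: "(\<lambda>m. A m / A (Suc m)) \<longlonglongrightarrow> 1"
proof -
  obtain a where a: "a > 0" "(\<lambda>m. A m * exp (- \<psi> (real (m + 1)))) \<longlonglongrightarrow> a"
    using A_asymp by blast
  have "(\<lambda>m. \<psi> (real (m + 2)) - \<psi> (real (m + 1))) \<longlonglongrightarrow> 0"
    by (rule \<psi>_diff_tendsto) simp
  then have "(\<lambda>m. (A m * exp (- \<psi> (real (m + 1)))) / (A (Suc m) * exp (- \<psi> (real (Suc m + 1))))
      * exp (- (\<psi> (real (m + 2)) - \<psi> (real (m + 1))))) \<longlonglongrightarrow> a / a * exp (- 0)"
    using a(1) by (intro tendsto_intros a(2) LIMSEQ_Suc[OF a(2)]) auto
  moreover have "(A m * exp (- \<psi> (real (m + 1)))) / (A (Suc m) * exp (- \<psi> (real (Suc m + 1))))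
      * exp (- (\<psi> (real (m + 2)) - \<psi> (real (m + 1)))) = A m / A (Suc m)" for m
    using A_pos[of "Suc m"] by (simp add: exp_minus exp_diff field_simps)
  ultimately show ?thesis using a(1) by simp
qed

text \<open>Dividing the Casoratian recursion by \<open>A (Suc m)\<close> gives the step from
  \<open>x\<close> to \<open>1 - z m * x\<close> with \<open>z\<close> tending to 1/2. The limiting
  map has the fixed point 2/3, and distances to it contract.\<close>

lemma rel_cross_tendsto: "rel_cross \<longlonglongrightarrow> 2 / 3"
proof -
  define z where "z m = \<theta> (m + 2) * (A m / A (Suc m))" for m
  have rec: "rel_cross (Suc m) = 1 - z m * rel_cross m" for m
    using A_pos[of m] A_pos[of "Suc m"]
    by (simp add: rel_cross_def z_def weight_cross_rec diff_divide_distrib)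
  have "(\<lambda>m. (1 + drift (m + 2)) / (2 - drift (m + 2)) * (A m / A (Suc m))) \<longlonglongrightarrow> (1 + 0) / (2 - 0) * 1"
    by (intro tendsto_intros A_ratio LIMSEQ_ignore_initial_segment[OF drift_tendsto]) auto
  then have z: "z \<longlonglongrightarrow> 1 / 2" unfolding z_def[abs_def] using \<theta> by simp
  have z0: "0 \<le> z m" for m
    using \<theta>_pos[of "m + 2"] A_pos[of m] A_pos[of "Suc m"] by (simp add: z_def)
  have "(\<lambda>m. \<bar>rel_cross m - 2 / 3\<bar>) \<longlonglongrightarrow> 0"
  proof (rule tendsto_0_contraction[where r = "3/4" and \<epsilon> = "\<lambda>m. \<bar>1 / 3 - z m * (2 / 3)\<bar>"])
    have "\<forall>\<^sub>F m in sequentially. z m < 3 / 4" by (rule order_tendstoD[OF z]) simp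
    then show "\<forall>\<^sub>F m in sequentially. \<bar>rel_cross (Suc m) - 2 / 3\<bar> \<le>
        3 / 4 * \<bar>rel_cross m - 2 / 3\<bar> + \<bar>1 / 3 - z m * (2 / 3)\<bar>"
    proof eventually_elim
      case (elim m)
      have "rel_cross (Suc m) - 2 / 3 = (1 / 3 - z m * (2 / 3)) - z m * (rel_cross m - 2 / 3)"
        by (simp add: rec algebra_simps)
      moreover have "\<bar>z m * (rel_cross m - 2 / 3)\<bar> \<le> 3 / 4 * \<bar>rel_cross m - 2 / 3\<bar>"
        using elim z0[of m] unfolding abs_mult by (intro mult_right_mono) auto
      ultimately show ?case by linarith
    qed
    have "(\<lambda>m. \<bar>1 / 3 - z m * (2 / 3)\<bar>) \<longlonglongrightarrow> \<bar>1 / 3 - 1 / 2 * (2 / 3)\<bar>"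
      by (intro tendsto_intros z)
    then show "(\<lambda>m. \<bar>1 / 3 - z m * (2 / 3)\<bar>) \<longlonglongrightarrow> 0" by simp
  qed auto
  then show ?thesis by (simp add: tendsto_rabs_zero_iff LIM_zero_iff)
qed

section \<open>Increments of the mass ratio and of the escape probability\<close>

lemma mass_ratio_increment: "mass_ratio (Suc m) - mass_ratio m = rel_cross m / A (Suc m)"
  using A_pos[of m] A_pos[of "Suc m"]
  by (simp add: mass_ratio_def rel_cross_def weight_cross_def field_simps)

lemma mass_ratio_ge_1: "1 \<le> mass_ratio m"
  using total_weight_ge[of \<theta> m, OF \<theta>_pos] A_pos[of m] by (simp add: mass_ratio_def)

text \<open>Up to sign this is the increment of \<open>1 / mass_ratio\<close>, so the Casoratian
  appears once more; each factor on the right has asymptotics of its own.\<close>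

lemma escape_increment:
  "A m / total_weight \<theta> m - A (Suc m) / total_weight \<theta> (Suc m) =
     rel_cross m / (A (Suc m) * mass_ratio m * mass_ratio (Suc m))"
proof -
  have "0 < total_weight \<theta> m" for m using total_weight_ge[of \<theta> m, OF \<theta>_pos] A_pos[of m] by linarith
  from this[of m] this[of "Suc m"] show ?thesis
    using A_pos[of m] A_pos[of "Suc m"]
    by (simp add: mass_ratio_def rel_cross_def weight_cross_def divide_simps)
qed

text \<open>The mean value theorem turns the increment into \<open>\<Phi>'\<close> at a nearby
  point, and \<open>\<psi>_diff_tendsto\<close> moves \<open>\<psi>\<close> from there to
  \<open>m + 2\<close>. So \<open>\<Phi>\<close> models \<open>mass_ratio\<close>, whose increments
  are of order \<open>exp (- \<psi>)\<close> as well.\<close>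

lemma potential_increment:
  assumes \<Phi>: "\<And>x. X0 \<le> x \<Longrightarrow> (\<Phi> has_real_derivative \<Phi>' x) (at x)"
    and lim: "((\<lambda>x. \<Phi>' x * exp (\<psi> x)) \<longlongrightarrow> 1) at_top"
  shows "(\<lambda>m. (\<Phi> (real (m + 2)) - \<Phi> (real (m + 1))) * exp (\<psi> (real (m + 2)))) \<longlonglongrightarrow> 1"
proof -
  have "\<exists>\<xi>. X0 \<le> real m \<longrightarrow> real (m + 1) < \<xi> \<and> \<xi> < real (m + 2) \<and>
      \<Phi> (real (m + 2)) - \<Phi> (real (m + 1)) = \<Phi>' \<xi>" for m
    using MVT2[of "real (m + 1)" "real (m + 2)" \<Phi> \<Phi>'] \<Phi> by force
  then obtain \<xi> where \<xi>: "\<And>m. X0 \<le> real m \<Longrightarrow> real (m + 1) < \<xi> m \<and> \<xi> m < real (m + 2) \<and>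
      \<Phi> (real (m + 2)) - \<Phi> (real (m + 1)) = \<Phi>' (\<xi> m)" by metis
  have "filterlim \<xi> at_top sequentially"
  proof (rule filterlim_at_top_mono[OF filterlim_real_sequentially])
    show "\<forall>\<^sub>F m in sequentially. real m \<le> \<xi> m"
      using eventually_real_ge[of X0] by eventually_elim (use \<xi> in force)
  qed
  then have "(\<lambda>m. \<Phi>' (\<xi> m) * exp (\<psi> (\<xi> m))) \<longlonglongrightarrow> 1"
    by (rule filterlim_compose[OF lim])
  moreover have "(\<lambda>m. \<psi> (real (m + 2)) - \<psi> (\<xi> m)) \<longlonglongrightarrow> 0"
  proof (rule \<psi>_diff_tendsto)
    show "\<forall>\<^sub>F m in sequentially. real m \<le> \<xi> m \<and> \<xi> m < real (m + 2) \<and> real (m + 2) \<le> \<xi> m + 1"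
      using eventually_real_ge[of X0] by eventually_elim (use \<xi> in force)
  qed
  ultimately have "(\<lambda>m. \<Phi>' (\<xi> m) * exp (\<psi> (\<xi> m)) * exp (\<psi> (real (m + 2)) - \<psi> (\<xi> m))) \<longlonglongrightarrow> 1 * exp 0"
    by (intro tendsto_intros)
  then have *: "(\<lambda>m. \<Phi>' (\<xi> m) * exp (\<psi> (real (m + 2)))) \<longlonglongrightarrow> 1"
    by (simp add: exp_diff)
  show ?thesis
  proof (rule Lim_transform_eventually[OF *])
    show "\<forall>\<^sub>F m in sequentially. \<Phi>' (\<xi> m) * exp (\<psi> (real (m + 2))) =
        (\<Phi> (real (m + 2)) - \<Phi> (real (m + 1))) * exp (\<psi> (real (m + 2)))"
      using eventually_real_ge[of X0] by eventually_elim (use \<xi> in simp)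
  qed
qed

section \<open>One-point asymptotics from a model \<open>\<Phi>\<close> of the mass ratio\<close>

context
  fixes a :: "nat \<Rightarrow> real" and \<Phi> \<Phi>' :: "real \<Rightarrow> real"
  assumes a: "\<And>m. 1 \<le> m \<Longrightarrow> a (m + 2) = A m / total_weight \<theta> m - A (Suc m) / total_weight \<theta> (Suc m)"
    and \<Phi>: "\<And>x. X0 \<le> x \<Longrightarrow> (\<Phi> has_real_derivative \<Phi>' x) (at x)"
    and \<Phi>'_lim: "((\<lambda>x. \<Phi>' x * exp (\<psi> x)) \<longlongrightarrow> 1) at_top"
begin

text \<open>The increments of \<open>mass_ratio\<close> are eventually bounded by a multiple of
  those of \<open>\<Phi>\<close>, which form a convergent series. Hence \<open>mass_ratio\<close>
  has a limit, at least 1, and \<open>A (Suc m)\<close> alone determines the order of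
  \<open>escape_increment\<close>.\<close>

lemma escape_asymp_bounded:
  assumes "(\<Phi> \<longlongrightarrow> L) at_top"
  shows "\<exists>c>0. a \<sim>[at_top] (\<lambda>n. c * exp (- \<psi> (real n)))"
proof -
  obtain \<alpha> where \<alpha>: "\<alpha> > 0" "(\<lambda>m. A m * exp (- \<psi> (real (m + 1)))) \<longlonglongrightarrow> \<alpha>"
    using A_asymp by blast
  note \<alpha>' = LIMSEQ_Suc[OF \<alpha>(2)]
  \<comment> \<open>The exponentials are inserted so that numerator and denominator converge
    separately; \<open>mult_exp_cancel\<close> removes them.\<close>
  have "(\<lambda>m. (rel_cross m / (A (Suc m) * exp (- \<psi> (real (Suc m + 1))))) /
      ((\<Phi> (real (m + 2)) - \<Phi> (real (m + 1))) * exp (\<psi> (real (m + 2))))) \<longlonglongrightarrow> (2 / 3 / \<alpha>) / 1"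
    using \<alpha>(1)
    by (intro tendsto_divide rel_cross_tendsto \<alpha>' potential_increment[OF \<Phi> \<Phi>'_lim]) auto
  then have "(\<lambda>m. (mass_ratio (Suc m) - mass_ratio m) / (\<Phi> (real (m + 2)) - \<Phi> (real (m + 1)))) \<longlonglongrightarrow> 2 / 3 / \<alpha>"
    by (simp add: mass_ratio_increment mult_exp_cancel)
  then have "Bseq (\<lambda>m. (mass_ratio (Suc m) - mass_ratio m) / (\<Phi> (real (m + 2)) - \<Phi> (real (m + 1))))"
    by (intro convergent_imp_Bseq) (auto simp: convergent_def)
  then obtain U where U: "\<And>m. \<bar>(mass_ratio (Suc m) - mass_ratio m) / (\<Phi> (real (m + 2)) - \<Phi> (real (m + 1)))\<bar> \<le> U"
    by (auto simp: Bseq_def)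
  have "\<forall>\<^sub>F m in sequentially. 0 < (\<Phi> (real (m + 2)) - \<Phi> (real (m + 1))) * exp (\<psi> (real (m + 2)))"
    by (rule order_tendstoD[OF potential_increment[OF \<Phi> \<Phi>'_lim]]) auto
  then have inc: "\<forall>\<^sub>F m in sequentially. 0 < \<Phi> (real (m + 2)) - \<Phi> (real (m + 1))"
    by eventually_elim (simp add: zero_less_mult_iff)
  have "(\<lambda>m. \<Phi> (real (m + 1))) \<longlonglongrightarrow> L"
    by (intro filterlim_compose[OF assms] filterlim_compose[OF filterlim_real_sequentially] filterlim_add_const_nat_at_top)
  then have "summable (\<lambda>m. \<Phi> (real (Suc m + 1)) - \<Phi> (real (m + 1)))"
    by (rule telescope_summable)
  then have "summable (\<lambda>m. U * (\<Phi> (real (m + 2)) - \<Phi> (real (m + 1))))"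
    by (intro summable_mult) (simp add: add_ac)
  then have "summable (\<lambda>m. mass_ratio (Suc m) - mass_ratio m)"
  proof (rule summable_comparison_test_ev[rotated])
    show "\<forall>\<^sub>F m in sequentially. norm (mass_ratio (Suc m) - mass_ratio m) \<le> U * (\<Phi> (real (m + 2)) - \<Phi> (real (m + 1)))"
      using inc
    proof eventually_elim
      case (elim m)
      with U[of m] show ?case by (simp add: abs_divide divide_le_eq)
    qed
  qed
  then have "convergent (\<lambda>n. \<Sum>m<n. mass_ratio (Suc m) - mass_ratio m)" by (simp add: summable_iff_convergent)
  then have "convergent (\<lambda>n. (mass_ratio n - mass_ratio 0) + mass_ratio 0)"
    by (subst (asm) sum_lessThan_telescope) (intro convergent_add convergent_const)
  then obtain t where t: "mass_ratio \<longlonglongrightarrow> t" by (auto simp: convergent_def)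
  have t1: "1 \<le> t" by (rule LIMSEQ_le_const[OF t]) (auto intro: mass_ratio_ge_1)
  show ?thesis
  proof (rule asymp_equiv_shift2I)
    have "(\<lambda>m. rel_cross m / (A (Suc m) * exp (- \<psi> (real (Suc m + 1))) * mass_ratio m * mass_ratio (Suc m)))
        \<longlonglongrightarrow> (2 / 3) / (\<alpha> * t * t)"
      using \<alpha>(1) t1 by (intro tendsto_divide tendsto_mult rel_cross_tendsto \<alpha>' t LIMSEQ_Suc[OF t]) auto
    then show "(\<lambda>m. a (m + 2) / exp (- \<psi> (real (m + 2)))) \<longlonglongrightarrow> (2 / 3) / (\<alpha> * t * t)"
    proof (rule Lim_transform_eventually)
      show "\<forall>\<^sub>F m in sequentially. rel_cross m / (A (Suc m) * exp (- \<psi> (real (Suc m + 1))) *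
          mass_ratio m * mass_ratio (Suc m)) = a (m + 2) / exp (- \<psi> (real (m + 2)))"
        using eventually_ge_at_top[of 1]
        by eventually_elim (subst a, simp, unfold escape_increment, simp add: mult_ac)
    qed
    show "(2 / 3) / (\<alpha> * t * t) > 0" using \<alpha>(1) t1 by simp
  qed simp
qed

text \<open>By Stolz-Cesaro \<open>mass_ratio\<close> is asymptotic to a multiple of
  \<open>\<Phi>\<close>, so the two mass ratios in \<open>escape_increment\<close> produce the
  square of \<open>\<Phi>\<close>.\<close>

lemma escape_asymp_unbounded:
  assumes top: "filterlim \<Phi> at_top at_top"
  shows "\<exists>c>0. a \<sim>[at_top] (\<lambda>n. c * (exp (- \<psi> (real n)) / (\<Phi> (real n))\<^sup>2))"
proof -
  obtain \<alpha> where \<alpha>: "\<alpha> > 0" "(\<lambda>m. A m * exp (- \<psi> (real (m + 1)))) \<longlonglongrightarrow> \<alpha>"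
    using A_asymp by blast
  note \<alpha>' = LIMSEQ_Suc[OF \<alpha>(2)]
  define f where "f m = \<Phi> (real (m + 1))" for m
  have Pinc: "(\<lambda>m. (f (Suc m) - f m) * exp (\<psi> (real (m + 2)))) \<longlonglongrightarrow> 1"
    using potential_increment[OF \<Phi> \<Phi>'_lim] by (simp add: f_def add_ac)
  have inc: "\<forall>\<^sub>F m in sequentially. f m < f (Suc m)"
  proof -
    have "\<forall>\<^sub>F m in sequentially. 0 < (f (Suc m) - f m) * exp (\<psi> (real (m + 2)))"
      by (rule order_tendstoD[OF Pinc]) auto
    then show ?thesis by eventually_elim (simp add: zero_less_mult_iff)
  qed
  have f_top: "filterlim f at_top sequentially"
    unfolding f_def
    by (intro filterlim_compose[OF top] filterlim_compose[OF filterlim_real_sequentially] filterlim_add_const_nat_at_top)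
  have "(\<lambda>m. (rel_cross m / (A (Suc m) * exp (- \<psi> (real (Suc m + 1))))) /
      ((f (Suc m) - f m) * exp (\<psi> (real (m + 2))))) \<longlonglongrightarrow> (2 / 3 / \<alpha>) / 1"
    using \<alpha>(1) by (intro tendsto_divide rel_cross_tendsto \<alpha>' Pinc) auto
  then have "(\<lambda>m. (mass_ratio (Suc m) - mass_ratio m) / (f (Suc m) - f m)) \<longlonglongrightarrow> 2 / 3 / \<alpha>"
    by (simp add: mass_ratio_increment mult_exp_cancel)
  then have t: "(\<lambda>m. mass_ratio m / f m) \<longlonglongrightarrow> 2 / 3 / \<alpha>"
    by (rule stolz_cesaro[OF inc f_top])
  have "(\<lambda>m. \<psi> (real (m + 3)) - \<psi> (real (m + 2))) \<longlonglongrightarrow> 0"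
    by (rule \<psi>_diff_tendsto) simp
  then have "(\<lambda>m. ((f (Suc m) - f m) * exp (\<psi> (real (m + 2)))) /
      ((f (Suc (Suc m)) - f (Suc m)) * exp (\<psi> (real (Suc m + 2)))) * exp (\<psi> (real (m + 3)) - \<psi> (real (m + 2)))) \<longlonglongrightarrow> 1 / 1 * exp 0"
    by (intro tendsto_intros Pinc LIMSEQ_Suc[OF Pinc]) auto
  moreover have "Suc m + 2 = m + 3" for m by simp
  ultimately have "(\<lambda>m. (f (Suc m) - f m) / (f (Suc (Suc m)) - f (Suc m))) \<longlonglongrightarrow> 1"
    by (simp only: exp_diff) simp
  \<comment> \<open>Stolz-Cesaro again, for \<open>f\<close> against its own shift; both mass ratios
    can then be compared with \<open>f (Suc m)\<close>.\<close>
  then have f_ratio: "(\<lambda>m. f m / f (Suc m)) \<longlonglongrightarrow> 1"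
  proof (rule stolz_cesaro[rotated 2])
    show "\<forall>\<^sub>F n in sequentially. f (Suc n) < f (Suc (Suc n))"
      using inc eventually_sequentially_Suc[of "\<lambda>m. f m < f (Suc m)"] by blast
    show "filterlim (\<lambda>n. f (Suc n)) at_top sequentially"
      using f_top filterlim_sequentially_Suc by blast
  qed
  have f_pos: "\<forall>\<^sub>F m in sequentially. 0 < f m"
    by (rule filterlim_at_top_dense[THEN iffD1, rule_format, OF f_top])
  show ?thesis
  proof (rule asymp_equiv_shift2I)
    let ?k = "(2 / 3) / (\<alpha> * ((2 / 3 / \<alpha>) * 1) * (2 / 3 / \<alpha>))"
    have "(\<lambda>m. rel_cross m / (A (Suc m) * exp (- \<psi> (real (Suc m + 1))) *
        (mass_ratio m / f m * (f m / f (Suc m))) * (mass_ratio (Suc m) / f (Suc m)))) \<longlonglongrightarrow> ?k"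
      using \<alpha>(1) by (intro tendsto_divide tendsto_mult rel_cross_tendsto \<alpha>' t f_ratio LIMSEQ_Suc[OF t]) auto
    then show "(\<lambda>m. a (m + 2) / (exp (- \<psi> (real (m + 2))) / (\<Phi> (real (m + 2)))\<^sup>2)) \<longlonglongrightarrow> ?k"
    proof (rule Lim_transform_eventually)
      show "\<forall>\<^sub>F m in sequentially. rel_cross m / (A (Suc m) * exp (- \<psi> (real (Suc m + 1))) *
        (mass_ratio m / f m * (f m / f (Suc m))) * (mass_ratio (Suc m) / f (Suc m))) =
        a (m + 2) / (exp (- \<psi> (real (m + 2))) / (\<Phi> (real (m + 2)))\<^sup>2)"
        using f_pos eventually_ge_at_top[of 1]
      proof eventually_elim
        case (elim m)
        have "\<Phi> (real (m + 2)) = f (Suc m)" by (simp add: f_def add_ac)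
        then show ?case
          using elim unfolding a[OF elim(2)] escape_increment by (simp add: power2_eq_square)
      qed
    qed
    show "?k > 0" using \<alpha>(1) by simp
    have "\<forall>\<^sub>F x in at_top. 0 < \<Phi> x" by (rule filterlim_at_top_dense[THEN iffD1, rule_format, OF top])
    then have "\<forall>\<^sub>F n in sequentially. 0 < \<Phi> (real n)"
      by (rule eventually_compose_filterlim[OF _ filterlim_real_sequentially])
    then show "\<forall>\<^sub>F n in sequentially. exp (- \<psi> (real n)) / (\<Phi> (real n))\<^sup>2 \<noteq> 0"
      by eventually_elim simp
  qed
qed

end

end

section \<open>The exit problem of the walk\<close>

text \<open>For the ratios \<open>p / q\<close> this is the probability of reaching 1 before
  exceeding \<open>m + 1\<close>: the harmonic function rebuilt from its differences, summed from
  the top and normalised to 1 at 1.\<close>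

definition lower_prob :: "(nat \<Rightarrow> real) \<Rightarrow> nat \<Rightarrow> nat \<Rightarrow> real" where
  "lower_prob \<theta> m j = (\<Sum>i=j..Suc m. path_weight \<theta> i (Suc m - i)) / total_weight \<theta> m"

lemma total_weight_eq: "total_weight \<theta> m = (\<Sum>i=1..Suc m. path_weight \<theta> i (Suc m - i))"
  unfolding total_weight_def
  by (rule sum.reindex_bij_witness[of _ "\<lambda>i. i - 1" Suc]) auto

context random_walk_12
begin

abbreviation \<theta> :: "nat \<Rightarrow> real" where "\<theta> \<equiv> \<lambda>i. p i / q i"

lemma \<theta>_pos: "2 \<le> i \<Longrightarrow> 0 < \<theta> i"
  using p_pos q_pos by simp

lemma total_weight_pos: "0 < total_weight \<theta> m"
  using total_weight_ge[of \<theta> m] path_weight_pos[of \<theta> 1 m] \<theta>_pos by fastforce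

lemma lower_prob_1: "lower_prob \<theta> m 1 = 1"
  using total_weight_pos[of m] by (simp add: lower_prob_def total_weight_eq)

lemma lower_prob_2: "lower_prob \<theta> m 2 = 1 - path_weight \<theta> 1 m / total_weight \<theta> m"
proof -
  have "total_weight \<theta> m = path_weight \<theta> 1 m + (\<Sum>i=2..Suc m. path_weight \<theta> i (Suc m - i))"
    unfolding total_weight_eq by (subst sum.atLeast_Suc_atMost) (simp_all add: numeral_2_eq_2)
  then show ?thesis using total_weight_pos[of m] unfolding lower_prob_def
    by (simp add: divide_simps)
qed

lemma lower_prob_above: "Suc m < j \<Longrightarrow> lower_prob \<theta> m j = 0"
  by (simp add: lower_prob_def)

lemma lower_prob_nonneg: "1 \<le> j \<Longrightarrow> 0 \<le> lower_prob \<theta> m j"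
  unfolding lower_prob_def
  by (intro divide_nonneg_pos sum_nonneg total_weight_pos less_imp_le[OF path_weight_pos] \<theta>_pos) auto

text \<open>Once the common sum is cancelled, harmonicity says that \<open>q j\<close> times one
  weight equals \<open>p j\<close> times the sum of the next two, which is
  \<open>path_weight_backward\<close>.\<close>

lemma lower_prob_harmonic:
  assumes "2 \<le> j" "j \<le> Suc m"
  shows "lower_prob \<theta> m j = q j * lower_prob \<theta> m (j - 1) + p j * lower_prob \<theta> m (j + 2)"
proof -
  define w where "w i = path_weight \<theta> i (Suc m - i)" for i
  define s where "s k = (\<Sum>i=k..Suc m. w i)" for k
  obtain k where k: "j = Suc k" "1 \<le> k" using assms by (cases j) auto
  have s: "s i = w i + s (Suc i)" if "i \<le> Suc m" for i
    unfolding s_def using that by (rule sum.atLeast_Suc_atMost)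
  have main: "q j * w k + p j * s (j + 2) = p j * s j"
  \<comment> \<open>At the top, truncated subtraction makes \<open>w (Suc j)\<close> equal to 1
    where the boundary value should be 0.\<close>
  proof (cases "j = Suc m")
    case True
    have "w k = \<theta> j" "s j = 1" "s (j + 2) = 0" using True k by (simp_all add: w_def s_def)
    then show ?thesis using q_pos[of j] assms by simp
  next
    case False
    then obtain d where d: "Suc m = k + Suc (Suc d)"
      using assms k by (metis Suc_leI add_Suc_right le_Suc_ex le_neq_implies_less add_Suc)
    have "w k = \<theta> j * (w j + w (Suc j))"
      unfolding w_def k d using path_weight_backward[of \<theta> k d] by simp
    moreover have "s j = w j + (w (Suc j) + s (j + 2))"
      using s[of j] s[of "Suc j"] assms False by simp
    ultimately show ?thesis using q_pos[of j] assms by (simp add: algebra_simps)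
  qed
  have "s k = w k + s j" using s[of k] k assms by simp
  then have "q j * s k + p j * s (j + 2) = (q j + p j) * s j"
    using main by (simp add: algebra_simps)
  then have "s j = q j * s k + p j * s (j + 2)" using q_plus_p[of j] assms by simp
  then show ?thesis
    unfolding lower_prob_def k by (simp add: s_def w_def k add_divide_distrib)
qed

lemma step_prob_sum:
  assumes "2 \<le> j" "j \<le> Suc m"
  shows "(\<Sum>i=1..m+3. step_prob_12 p q j i * lower_prob \<theta> m i) = lower_prob \<theta> m j"
proof -
  have "(\<Sum>i=1..m+3. step_prob_12 p q j i * lower_prob \<theta> m i) =
      (\<Sum>i\<in>{j - 1, j + 2}. step_prob_12 p q j i * lower_prob \<theta> m i)"
    using assms by (intro sum.mono_neutral_right) (auto simp: step_prob_12_def)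
  also have "\<dots> = lower_prob \<theta> m j"
  proof -
    have "j - 1 \<noteq> j + 2" "j + 2 \<noteq> j - 1" by auto
    then show ?thesis using assms by (simp add: step_prob_12_def lower_prob_harmonic[OF assms])
  qed
  finally show ?thesis .
qed

section \<open>Taboo probabilities and the exit at 1\<close>

lemma Y_pred_measurable [measurable]: "Measurable.pred P (\<lambda>\<omega>. Q (Y k \<omega>))"
  by (rule measurable_compose[OF Y_measurable]) simp

text \<open>The position at time \<open>k\<close> is not restricted, so for \<open>0 < k\<close> the
  value \<open>y = 1\<close> describes a downward exit from \<open>{2..N}\<close> at time
  \<open>k\<close>.\<close>

definition taboo_prob :: "nat \<Rightarrow> nat \<Rightarrow> nat \<Rightarrow> real" where
  "taboo_prob N k y = \<P>(\<omega> in P. (\<forall>i<k. Y i \<omega> \<in> {2..N}) \<and> Y k \<omega> = y)"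

text \<open>For histories of probability 0 the Markov property is silent, but then both sides
  vanish.\<close>

lemma cylinder_step:
  "\<P>(\<omega> in P. (\<forall>i\<le>k. Y i \<omega> = h i) \<and> Y (Suc k) \<omega> = z) =
     \<P>(\<omega> in P. \<forall>i\<le>k. Y i \<omega> = h i) * step_prob_12 p q (h k) z"
proof (cases "\<P>(\<omega> in P. \<forall>i\<le>k. Y i \<omega> = h i) = 0")
  case True
  have "\<P>(\<omega> in P. (\<forall>i\<le>k. Y i \<omega> = h i) \<and> Y (Suc k) \<omega> = z) \<le> \<P>(\<omega> in P. \<forall>i\<le>k. Y i \<omega> = h i)"
    by (rule finite_measure_mono) auto
  with True show ?thesis using measure_nonneg[of P] by (simp add: order_antisym)
next
  case False
  then have "0 < \<P>(\<omega> in P. \<forall>i\<le>k. Y i \<omega> = h i)" using measure_nonneg[of P] by (simp add: less_le)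
  from markov[OF this, of z] False show ?thesis
    by (simp add: cond_prob_def divide_simps conj_commute mult.commute)
qed

text \<open>The Markov property speaks of complete histories. The event is split into the finitely
  many histories in \<open>{2..N}\<close> before time \<open>k\<close>, each extended by
  \<open>y\<close>.\<close>

lemma taboo_step:
  "\<P>(\<omega> in P. (\<forall>i<k. Y i \<omega> \<in> {2..N}) \<and> Y k \<omega> = y \<and> Y (Suc k) \<omega> = z) =
     taboo_prob N k y * step_prob_12 p q y z"
proof -
  let ?H = "PiE {..<k} (\<lambda>_. {2..N})"
  let ?c = "\<lambda>h. {\<omega> \<in> space P. \<forall>i\<le>k. Y i \<omega> = (h(k := y)) i}"
  let ?d = "\<lambda>h. {\<omega> \<in> space P. (\<forall>i\<le>k. Y i \<omega> = (h(k := y)) i) \<and> Y (Suc k) \<omega> = z}"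
  have fin: "finite ?H" by (intro finite_PiE) auto
  have hist: "restrict (\<lambda>i. Y i \<omega>) {..<k} \<in> ?H" if "\<forall>i<k. Y i \<omega> \<in> {2..N}" for \<omega>
    using that by auto
  have cover: "(\<exists>h\<in>?H. \<forall>i\<le>k. Y i \<omega> = (h(k := y)) i) \<longleftrightarrow> (\<forall>i<k. Y i \<omega> \<in> {2..N}) \<and> Y k \<omega> = y" for \<omega>
  proof
    assume "(\<forall>i<k. Y i \<omega> \<in> {2..N}) \<and> Y k \<omega> = y"
    then show "\<exists>h\<in>?H. \<forall>i\<le>k. Y i \<omega> = (h(k := y)) i"
      by (intro bexI[OF _ hist]) auto
  next
    assume "\<exists>h\<in>?H. \<forall>i\<le>k. Y i \<omega> = (h(k := y)) i"
    then obtain h where h: "h \<in> ?H" "\<forall>i\<le>k. Y i \<omega> = (h(k := y)) i" by blast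
    have "Y i \<omega> \<in> {2..N}" if "i < k" for i
      using h(2)[rule_format, of i] PiE_mem[OF h(1), of i] that by simp
    moreover have "Y k \<omega> = y" using h(2)[rule_format, of k] by simp
    ultimately show "(\<forall>i<k. Y i \<omega> \<in> {2..N}) \<and> Y k \<omega> = y" by blast
  qed
  have inj: "h = h'" if "h \<in> ?H" "h' \<in> ?H" "\<forall>i\<le>k. Y i \<omega> = (h(k := y)) i" "\<forall>i\<le>k. Y i \<omega> = (h'(k := y)) i" for h h' \<omega>
  proof (rule PiE_ext[OF that(1,2)])
    fix i assume "i \<in> {..<k}"
    then show "h i = h' i" using that(3,4)[rule_format, of i] by simp
  qed
  have "{\<omega> \<in> space P. (\<forall>i<k. Y i \<omega> \<in> {2..N}) \<and> Y k \<omega> = y \<and> Y (Suc k) \<omega> = z} = (\<Union>h\<in>?H. ?d h)"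
    unfolding conj_assoc[symmetric] cover[symmetric] by blast
  then have "\<P>(\<omega> in P. (\<forall>i<k. Y i \<omega> \<in> {2..N}) \<and> Y k \<omega> = y \<and> Y (Suc k) \<omega> = z) = measure P (\<Union>h\<in>?H. ?d h)"
    by (rule arg_cong)
  also have "\<dots> = (\<Sum>h\<in>?H. measure P (?d h))"
  proof (rule finite_measure_finite_Union[OF fin])
    show "disjoint_family_on ?d ?H" unfolding disjoint_family_on_def using inj by blast
    show "?d ` ?H \<subseteq> sets P" by (intro image_subsetI) measurable
  qed
  also have "\<dots> = (\<Sum>h\<in>?H. measure P (?c h) * step_prob_12 p q y z)"
    by (intro sum.cong refl) (simp add: cylinder_step)
  also have "\<dots> = (\<Sum>h\<in>?H. measure P (?c h)) * step_prob_12 p q y z"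
    by (simp add: sum_distrib_right)
  also have "(\<Sum>h\<in>?H. measure P (?c h)) = measure P (\<Union>h\<in>?H. ?c h)"
  proof (rule finite_measure_finite_Union[OF fin, symmetric])
    show "disjoint_family_on ?c ?H" unfolding disjoint_family_on_def using inj by blast
    show "?c ` ?H \<subseteq> sets P" by (intro image_subsetI) measurable
  qed
  also have "\<dots> = taboo_prob N k y"
    unfolding taboo_prob_def cover[symmetric] by (rule arg_cong[where f = "measure P"]) blast
  finally show ?thesis .
qed

lemma taboo_rec: "taboo_prob N (Suc k) z = (\<Sum>y=2..N. taboo_prob N k y * step_prob_12 p q y z)"
proof -
  let ?d = "\<lambda>y. {\<omega> \<in> space P. (\<forall>i<k. Y i \<omega> \<in> {2..N}) \<and> Y k \<omega> = y \<and> Y (Suc k) \<omega> = z}"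
  have "taboo_prob N (Suc k) z = measure P (\<Union>y\<in>{2..N}. ?d y)" unfolding taboo_prob_def
    by (rule arg_cong[where f = "measure P"]) (auto simp: less_Suc_eq)
  also have "\<dots> = (\<Sum>y\<in>{2..N}. measure P (?d y))"
    by (rule finite_measure_finite_Union) (auto simp: disjoint_family_on_def)
  finally show ?thesis unfolding taboo_step .
qed

lemma taboo_nonneg: "0 \<le> taboo_prob N k y"
  by (simp add: taboo_prob_def)

lemma step_prob_nonneg: "2 \<le> n \<Longrightarrow> 0 \<le> step_prob_12 p q n m"
  using p_pos[of n] q_pos[of n] by (simp add: step_prob_12_def)

lemma taboo_Suc_0: "taboo_prob N (Suc k) 0 = 0"
  unfolding taboo_rec by (intro sum.neutral) (auto simp: step_prob_12_def)

text \<open>Used to pass decay in \<open>k\<close> from one level to the level above.\<close>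

lemma taboo_down: "2 \<le> y \<Longrightarrow> y \<le> N \<Longrightarrow> q y * taboo_prob N k y \<le> taboo_prob N (Suc k) (y - 1)"
proof -
  assume y: "2 \<le> y" "y \<le> N"
  have "taboo_prob N k y * step_prob_12 p q y (y - 1) \<le> taboo_prob N (Suc k) (y - 1)"
    unfolding taboo_rec using y
    by (intro member_le_sum[where f = "\<lambda>y'. taboo_prob N k y' * step_prob_12 p q y' (y - 1)"])
      (auto intro!: mult_nonneg_nonneg taboo_nonneg step_prob_nonneg)
  then show ?thesis using y by (simp add: step_prob_12_def mult.commute)
qed

text \<open>One step conserves the total of the harmonic function: mass leaving at 1 carries the
  value 1, mass leaving above \<open>m + 1\<close> the value 0.\<close>

lemma lower_prob_martingale:
  "(\<Sum>y=2..Suc m. taboo_prob (Suc m) k y * lower_prob \<theta> m y) =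
     (\<Sum>y=2..Suc m. taboo_prob (Suc m) (Suc k) y * lower_prob \<theta> m y) + taboo_prob (Suc m) (Suc k) 1"
proof -
  have "(\<Sum>y=2..Suc m. taboo_prob (Suc m) k y * lower_prob \<theta> m y) =
      (\<Sum>y=2..Suc m. taboo_prob (Suc m) k y * (\<Sum>i=1..m+3. step_prob_12 p q y i * lower_prob \<theta> m i))"
  proof (rule sum.cong)
    fix y assume "y \<in> {2..Suc m}"
    then show "taboo_prob (Suc m) k y * lower_prob \<theta> m y =
        taboo_prob (Suc m) k y * (\<Sum>i=1..m+3. step_prob_12 p q y i * lower_prob \<theta> m i)"
      by (subst step_prob_sum) auto
  qed simp
  also have "\<dots> = (\<Sum>i=1..m+3. (\<Sum>y=2..Suc m. taboo_prob (Suc m) k y * step_prob_12 p q y i) * lower_prob \<theta> m i)"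
    unfolding sum_distrib_left sum_distrib_right by (subst sum.swap) (simp add: mult_ac)
  also have "\<dots> = (\<Sum>i=1..m+3. taboo_prob (Suc m) (Suc k) i * lower_prob \<theta> m i)"
    unfolding taboo_rec ..
  also have "\<dots> = (\<Sum>i=1..Suc m. taboo_prob (Suc m) (Suc k) i * lower_prob \<theta> m i)"
    by (intro sum.mono_neutral_right) (auto simp: lower_prob_above)
  also have "\<dots> = taboo_prob (Suc m) (Suc k) 1 * lower_prob \<theta> m 1 + (\<Sum>i=2..Suc m. taboo_prob (Suc m) (Suc k) i * lower_prob \<theta> m i)"
    by (subst sum.atLeast_Suc_atMost) (simp_all add: numeral_2_eq_2)
  finally show ?thesis unfolding lower_prob_1 by simp
qed

text \<open>The martingale identity telescopes with remainder \<open>?W n\<close>. The exit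
  probabilities at 1 are summable and so tend to 0; \<open>taboo_down\<close> carries this up
  through finitely many levels, and the remainder vanishes.\<close>

lemma taboo_exit_sums:
  assumes start: "AE \<omega> in P. Y 0 \<omega> = 2" and m: "1 \<le> m"
  shows "(\<lambda>k. taboo_prob (Suc m) (Suc k) 1) sums lower_prob \<theta> m 2"
proof -
  let ?W = "\<lambda>k. \<Sum>y=2..Suc m. taboo_prob (Suc m) k y * lower_prob \<theta> m y"
  have t0: "taboo_prob (Suc m) 0 y = (if y = 2 then 1 else 0)" for y
  proof (cases "y = 2")
    case True
    have "prob {\<omega> \<in> space P. Y 0 \<omega> = 2} = 1" using start by (subst prob_Collect_eq_1) auto
    then show ?thesis using True by (simp add: taboo_prob_def)
  next
    case False
    have "AE \<omega> in P. \<not> (Y 0 \<omega> = y)" using start by eventually_elim (use False in simp)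
    then have "prob {\<omega> \<in> space P. Y 0 \<omega> = y} = 0" by (subst prob_Collect_eq_0) auto
    then show ?thesis using False by (simp add: taboo_prob_def)
  qed
  have W0: "?W 0 = lower_prob \<theta> m 2"
  proof -
    have "?W 0 = (\<Sum>y=2..Suc m. if y = 2 then lower_prob \<theta> m y else 0)"
      by (intro sum.cong refl) (simp add: t0)
    also have "\<dots> = lower_prob \<theta> m 2" using m by (subst sum.delta) auto
    finally show ?thesis .
  qed
  have partial: "(\<Sum>k<n. taboo_prob (Suc m) (Suc k) 1) = lower_prob \<theta> m 2 - ?W n" for n
  proof (induction n)
    case (Suc n)
    then show ?case using lower_prob_martingale[of m n] by simp
  qed (simp only: W0 lessThan_0 sum.empty diff_self)
  have W_nonneg: "0 \<le> ?W n" for n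
    by (intro sum_nonneg mult_nonneg_nonneg taboo_nonneg lower_prob_nonneg) auto
  have "summable (\<lambda>k. taboo_prob (Suc m) (Suc k) 1)"
    by (rule summableI_nonneg_bounded[where x = "lower_prob \<theta> m 2"])
      (use partial W_nonneg taboo_nonneg in auto)
  then have exit0: "(\<lambda>k. taboo_prob (Suc m) (Suc k) 1) \<longlonglongrightarrow> 0"
    by (rule summable_LIMSEQ_zero)
  have to_0: "(\<lambda>k. taboo_prob (Suc m) k y) \<longlonglongrightarrow> 0" if "1 \<le> y" "y \<le> Suc m" for y
    using that
  proof (induction y rule: dec_induct)
    case base
    show ?case by (rule LIMSEQ_imp_Suc) (use exit0 in simp)
  next
    case (step y)
    have q: "0 < q (Suc y)" using step by (intro q_pos) auto
    have "(\<lambda>k. taboo_prob (Suc m) k y) \<longlonglongrightarrow> 0" using step by simp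
    then have "(\<lambda>k. taboo_prob (Suc m) (Suc k) y / q (Suc y)) \<longlonglongrightarrow> 0 / q (Suc y)"
      using q by (intro tendsto_divide[OF LIMSEQ_Suc tendsto_const]) auto
    then have lim: "(\<lambda>k. taboo_prob (Suc m) (Suc k) y / q (Suc y)) \<longlonglongrightarrow> 0" by simp
    show ?case
    proof (rule real_tendsto_sandwich[OF _ _ tendsto_const lim])
      show "\<forall>\<^sub>F k in sequentially. taboo_prob (Suc m) k (Suc y) \<le> taboo_prob (Suc m) (Suc k) y / q (Suc y)"
        using taboo_down[of "Suc y" "Suc m"] step q by (simp add: field_simps)
    qed (simp add: taboo_nonneg)
  qed
  have "?W \<longlonglongrightarrow> (\<Sum>y=2..Suc m. 0 * lower_prob \<theta> m y)"
    by (intro tendsto_intros to_0) auto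
  then have "(\<lambda>n. lower_prob \<theta> m 2 - ?W n) \<longlonglongrightarrow> lower_prob \<theta> m 2 - 0"
    by (intro tendsto_intros) simp
  then show ?thesis unfolding sums_def partial by simp
qed

section \<open>The events of the excursion maximum\<close>

lemma exit_time_ge_iff: "enat k \<le> exit_time Y \<omega> \<longleftrightarrow> (\<forall>i. 1 \<le> i \<and> Y i \<omega> < Y 0 \<omega> \<longrightarrow> k \<le> i)"
  by (auto simp: exit_time_def le_INF_iff)

lemma exit_time_finite_iff: "exit_time Y \<omega> < \<infinity> \<longleftrightarrow> (\<exists>i. 1 \<le> i \<and> Y i \<omega> < Y 0 \<omega>)"
  unfolding exit_time_def INF_less_iff by auto

lemma excursion_max_le_enat_iff:
  "excursion_max Y \<omega> \<le> enat n \<longleftrightarrow> (\<forall>k. enat k \<le> exit_time Y \<omega> \<longrightarrow> Y k \<omega> \<le> n)"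
  by (auto simp: excursion_max_def SUP_le_iff)

text \<open>Upper bounds on the supremum unfold to countably many conditions on the walk, which
  serves both measurability and subtraction of levels.\<close>

lemma excursion_max_eq_Suc_iff:
  "excursion_max Y \<omega> = enat (Suc n) \<longleftrightarrow>
     excursion_max Y \<omega> \<le> enat (Suc n) \<and> \<not> excursion_max Y \<omega> \<le> enat n"
  by (cases "excursion_max Y \<omega>") auto

lemma excursion_event_measurable [measurable]:
  "{\<omega> \<in> space P. excursion_max Y \<omega> = enat (Suc n) \<and> exit_time Y \<omega> < \<infinity>} \<in> sets P"
proof -
  have [measurable]: "Measurable.pred P (\<lambda>\<omega>. Y i \<omega> < Y 0 \<omega>)" for i
  proof -
    \<comment> \<open>Measurability is known for predicates of a single \<open>Y k\<close>; a
      countable quantifier over the value of \<open>Y 0\<close> separates the two positions.\<close>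
    have eq: "(\<lambda>\<omega>. Y i \<omega> < Y 0 \<omega>) = (\<lambda>\<omega>. \<exists>y. Y 0 \<omega> = y \<and> Y i \<omega> < y)" by auto
    show ?thesis unfolding eq by measurable
  qed
  show ?thesis
    unfolding excursion_max_eq_Suc_iff excursion_max_le_enat_iff exit_time_ge_iff exit_time_finite_iff
    by measurable
qed

text \<open>For a start at 2 and \<open>2 \<le> N\<close>, the event that the excursion ends at time
  \<open>k\<close> without exceeding \<open>N\<close>.\<close>

definition exit_at :: "nat \<Rightarrow> nat \<Rightarrow> 'a set" where
  "exit_at N k = {\<omega> \<in> space P. (\<forall>i<k. Y i \<omega> \<in> {2..N}) \<and> Y k \<omega> < 2}"

lemma exit_at_measurable [measurable]: "exit_at N k \<in> sets P"
  unfolding exit_at_def by measurable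

lemma exit_at_disjoint: "disjoint_family (exit_at N)"
proof -
  have "exit_at N i \<inter> exit_at N j = {}" if "i < j" for i j
    using that by (auto simp: exit_at_def not_less)
  then show ?thesis by (auto simp: disjoint_family_on_def) (metis Int_commute disjoint_iff linorder_neqE_nat)
qed

lemma prob_exit_at: "prob (exit_at N k) = taboo_prob N k 0 + taboo_prob N k 1"
proof -
  have "exit_at N k = {\<omega> \<in> space P. (\<forall>i<k. Y i \<omega> \<in> {2..N}) \<and> Y k \<omega> = 0} \<union>
      {\<omega> \<in> space P. (\<forall>i<k. Y i \<omega> \<in> {2..N}) \<and> Y k \<omega> = 1}"
    by (auto simp: exit_at_def)
  then show ?thesis unfolding taboo_prob_def by (subst finite_measure_Union[symmetric]) auto
qed

lemma prob_exit_union: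
  assumes start: "AE \<omega> in P. Y 0 \<omega> = 2" and m: "1 \<le> m"
  shows "prob (\<Union>k. exit_at (Suc m) k) = 1 - path_weight \<theta> 1 m / total_weight \<theta> m"
proof -
  have "(\<lambda>k. prob (exit_at (Suc m) k)) sums prob (\<Union>k. exit_at (Suc m) k)"
    by (rule finite_measure_UNION) (auto simp: exit_at_disjoint)
  moreover have "prob (exit_at (Suc m) 0) = 0"
    unfolding exit_at_def using start by (subst prob_Collect_eq_0) auto
  ultimately have "(\<lambda>k. prob (exit_at (Suc m) (Suc k))) sums prob (\<Union>k. exit_at (Suc m) k)"
    using sums_Suc_iff[of "\<lambda>k. prob (exit_at (Suc m) k)"] by simp
  moreover have "(\<lambda>k. prob (exit_at (Suc m) (Suc k))) sums lower_prob \<theta> m 2"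
    unfolding prob_exit_at taboo_Suc_0 using taboo_exit_sums[OF assms] by simp
  ultimately show ?thesis unfolding lower_prob_2 by (metis sums_unique2)
qed

text \<open>The excursion ends at the least time \<open>d\<close> with position below 2. The
  supremum includes that position, which respects the bound because
  \<open>2 \<le> N\<close>.\<close>

lemma excursion_max_le_iff:
  assumes "Y 0 \<omega> = 2" "2 \<le> N" "\<omega> \<in> space P"
  shows "excursion_max Y \<omega> \<le> enat N \<and> exit_time Y \<omega> < \<infinity> \<longleftrightarrow> \<omega> \<in> (\<Union>k. exit_at N k)"
proof
  assume *: "excursion_max Y \<omega> \<le> enat N \<and> exit_time Y \<omega> < \<infinity>"
  then obtain k0 where k0: "1 \<le> k0 \<and> Y k0 \<omega> < 2"
    using assms(1) unfolding exit_time_finite_iff by auto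
  define d where "d = (LEAST k. 1 \<le> k \<and> Y k \<omega> < 2)"
  have d: "1 \<le> d \<and> Y d \<omega> < 2" unfolding d_def by (rule LeastI) (rule k0)
  have d_le: "d \<le> k" if "1 \<le> k \<and> Y k \<omega> < 2" for k unfolding d_def using that by (rule Least_le)
  have "Y i \<omega> \<in> {2..N}" if "i < d" for i
  proof -
    have "enat i \<le> exit_time Y \<omega>"
      using d_le that assms(1) by (force simp: exit_time_ge_iff)
    then have "Y i \<omega> \<le> N" using * by (simp add: excursion_max_le_enat_iff)
    moreover have "\<not> Y i \<omega> < 2"
    proof
      assume "Y i \<omega> < 2"
      moreover from this have "1 \<le> i" using assms(1) by (cases i) auto
      ultimately show False using d_le[of i] that by simp
    qed
    ultimately show ?thesis by simp
  qed
  then show "\<omega> \<in> (\<Union>k. exit_at N k)" using d assms(3) by (auto simp: exit_at_def)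
next
  assume "\<omega> \<in> (\<Union>k. exit_at N k)"
  then obtain d where d: "\<And>i. i < d \<Longrightarrow> Y i \<omega> \<in> {2..N}" "Y d \<omega> < 2" by (auto simp: exit_at_def)
  have d0: "1 \<le> d" using d assms(1) by (cases d) auto
  have "Y i \<omega> \<le> N" if "enat i \<le> exit_time Y \<omega>" for i
  proof -
    have "i \<le> d" using that d(2) d0 assms(1) by (auto simp: exit_time_ge_iff)
    then show ?thesis using d(1)[of i] d(2) assms(2) by (cases "i = d") auto
  qed
  then show "excursion_max Y \<omega> \<le> enat N \<and> exit_time Y \<omega> < \<infinity>"
    unfolding excursion_max_le_enat_iff exit_time_finite_iff using d(2) d0 assms(1) by auto
qed

text \<open>The exit events grow with the level, so the maximum is \<open>m + 2\<close> on the
  difference of two consecutive ones, up to a null set where the walk does not start at 2.\<close>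

lemma excursion_max_prob_eq:
  assumes start: "AE \<omega> in P. Y 0 \<omega> = 2" and m: "1 \<le> m"
  shows "excursion_max_prob P Y (m + 2) =
    path_weight \<theta> 1 m / total_weight \<theta> m - path_weight \<theta> 1 (Suc m) / total_weight \<theta> (Suc m)"
proof -
  let ?U = "\<lambda>N. \<Union>k. exit_at N k"
  have sub: "?U (Suc m) \<subseteq> ?U (Suc (Suc m))" by (fastforce simp: exit_at_def)
  have mem: "excursion_max Y \<omega> = enat (m + 2) \<and> exit_time Y \<omega> < \<infinity> \<longleftrightarrow> \<omega> \<in> ?U (Suc (Suc m)) - ?U (Suc m)"
    if "\<omega> \<in> space P" "Y 0 \<omega> = 2" for \<omega>
  proof -
    show ?thesis
      using excursion_max_le_iff[of \<omega> "Suc m"] excursion_max_le_iff[of \<omega> "Suc (Suc m)"] that m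
        excursion_max_eq_Suc_iff[of \<omega> "Suc m"] by auto
  qed
  let ?E = "{\<omega> \<in> space P. excursion_max Y \<omega> = enat (m + 2) \<and> exit_time Y \<omega> < \<infinity>}"

  have "excursion_max_prob P Y (m + 2) = prob ?E" by (simp add: excursion_max_prob_def)
  also have "prob ?E = prob (?U (Suc (Suc m)) - ?U (Suc m))"
  proof (rule finite_measure_eq_AE)
    show "AE \<omega> in P. \<omega> \<in> ?E \<longleftrightarrow> \<omega> \<in> ?U (Suc (Suc m)) - ?U (Suc m)"
      using start AE_space by eventually_elim (use mem in simp)
    show "?E \<in> events" using excursion_event_measurable[of "Suc m"] by simp
  qed measurable
  also have "\<dots> = prob (?U (Suc (Suc m))) - prob (?U (Suc m))"
    using sub by (intro finite_measure_Diff) auto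
  also have "\<dots> = path_weight \<theta> 1 m / total_weight \<theta> m - path_weight \<theta> 1 (Suc m) / total_weight \<theta> (Suc m)"
    using prob_exit_union[OF start, of m] prob_exit_union[OF start, of "Suc m"] m by simp
  finally show ?thesis .
qed

end

section \<open>Iterated logarithms\<close>

lemma iter_log_0 [simp]: "iter_log 0 x = x"
  and iter_log_Suc: "iter_log (Suc k) x = ln (iter_log k x)"
  by (simp_all add: iter_log_def)

lemma filterlim_iter_log: "filterlim (iter_log k) at_top at_top"
proof (induction k)
  case 0
  then show ?case by (simp add: filterlim_ident)
next
  case (Suc k)
  then show ?case unfolding iter_log_Suc by (rule filterlim_compose[OF ln_at_top])
qed

lemma eventually_iter_log_ge: "\<forall>\<^sub>F x in at_top. \<forall>j\<le>K. C \<le> iter_log j x"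
proof -
  have "\<forall>\<^sub>F x in at_top. \<forall>j\<in>{..K}. C \<le> iter_log j x"
    by (intro eventually_ball_finite ballI filterlim_at_top[THEN iffD1, rule_format, OF filterlim_iter_log]) simp
  then show ?thesis by (rule eventually_mono) auto
qed

definition log_prod :: "nat \<Rightarrow> real \<Rightarrow> real" where
  "log_prod k x = (\<Prod>j<k. iter_log j x)"

lemma log_prod_pos: "(\<And>j. j < k \<Longrightarrow> 0 < iter_log j x) \<Longrightarrow> 0 < log_prod k x"
  unfolding log_prod_def by (rule prod_pos) simp

lemma has_real_derivative_iter_log:
  assumes "\<And>j. j < k \<Longrightarrow> 0 < iter_log j x"
  shows "(iter_log k has_real_derivative 1 / log_prod k x) (at x)"
  using assms
proof (induction k)
  case 0
  show ?case by (simp add: log_prod_def iter_log_def DERIV_ident)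
next
  case (Suc k)
  have "((\<lambda>x. ln (iter_log k x)) has_real_derivative 1 / iter_log k x * (1 / log_prod k x)) (at x)"
    using Suc by (intro DERIV_chain2[OF DERIV_ln_divide]) auto
  then show ?case by (simp add: iter_log_Suc[abs_def] log_prod_def mult.commute)
qed

text \<open>An antiderivative of \<open>log_drift\<close>, in the role of \<open>\<psi>\<close>:
  \<open>iter_log k\<close> has the derivative \<open>1 / log_prod k\<close>.\<close>

definition log_potential :: "nat \<Rightarrow> real \<Rightarrow> real \<Rightarrow> real" where
  "log_potential K B x = (\<Sum>m<K - 1. iter_log (Suc m) x) + B * iter_log K x"

definition log_drift :: "nat \<Rightarrow> real \<Rightarrow> real \<Rightarrow> real" where
  "log_drift K B x = (\<Sum>m<K - 1. 1 / log_prod (Suc m) x) + B / log_prod K x"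

lemma Lambda_eq_log_drift: "Lambda K i B = log_drift K B (real i)"
  by (simp add: Lambda_def log_drift_def log_prod_def lessThan_Suc_atMost)

lemma exp_log_potential:
  assumes "1 \<le> K" "\<And>j. j < K \<Longrightarrow> 0 < iter_log j x"
  shows "exp (log_potential K B x) = log_prod (K - 1) x * iter_log (K - 1) x powr B"
proof -
  have "exp (\<Sum>m<K - 1. iter_log (Suc m) x) = log_prod (K - 1) x"
    unfolding exp_sum[OF finite_lessThan] log_prod_def
    by (intro prod.cong refl) (use assms in \<open>simp add: iter_log_Suc\<close>)
  moreover have "exp (B * iter_log K x) = iter_log (K - 1) x powr B"
  proof -
    have "iter_log K x = ln (iter_log (K - 1) x)" using assms(1) by (cases K) (auto simp: iter_log_Suc)
    then show ?thesis using assms(1) assms(2)[of "K - 1"] by (simp add: powr_def)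
  qed
  ultimately show ?thesis by (simp add: log_potential_def exp_add)
qed

lemma has_real_derivative_log_potential:
  assumes "\<And>j. j < K \<Longrightarrow> 0 < iter_log j x"
  shows "(log_potential K B has_real_derivative log_drift K B x) (at x)"
  unfolding log_potential_def log_drift_def
proof (intro DERIV_add DERIV_sum)
  show "((\<lambda>x. B * iter_log K x) has_real_derivative B / log_prod K x) (at x)"
    using DERIV_cmult[OF has_real_derivative_iter_log[OF assms], where c = B] by simp
qed (use assms in \<open>auto intro!: has_real_derivative_iter_log\<close>)

section \<open>Monotonicity and size of the logarithmic drift\<close>

context
  fixes K :: nat and X0 :: real
  assumes ge1: "\<And>x j. X0 \<le> x \<Longrightarrow> j < K \<Longrightarrow> 1 \<le> iter_log j x"
begin

lemma iter_log_mono: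
  assumes "X0 \<le> x" "x \<le> y" "j < K"
  shows "iter_log j x \<le> iter_log j y"
  using assms(3)
proof (induction j)
  case (Suc j)
  have "1 \<le> iter_log j x" "1 \<le> iter_log j y" using ge1[of x j] ge1[of y j] assms Suc by auto
  then show ?case using Suc by (simp add: iter_log_Suc)
qed (use assms in simp)

lemma log_prod_mono:
  assumes "X0 \<le> x" "x \<le> y" "k \<le> K"
  shows "log_prod k x \<le> log_prod k y"
  unfolding log_prod_def
proof (rule prod_mono)
  fix j assume "j \<in> {..<k}"
  then show "0 \<le> iter_log j x \<and> iter_log j x \<le> iter_log j y"
    using ge1[of x j] iter_log_mono[of x y j] assms by auto
qed

lemma log_prod_ge:
  assumes "X0 \<le> x" "1 \<le> k" "k \<le> K"
  shows "x \<le> log_prod k x"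
proof -
  have "1 \<le> (\<Prod>j\<in>{1..<k}. iter_log j x)"
    using ge1[OF assms(1)] assms by (intro prod_ge_1) auto
  moreover have "log_prod k x = x * (\<Prod>j\<in>{1..<k}. iter_log j x)"
    unfolding log_prod_def lessThan_atLeast0 using assms by (subst prod.atLeast_Suc_lessThan) auto
  moreover have "1 \<le> x" using ge1[OF assms(1), of 0] assms by simp
  ultimately show ?thesis by (simp add: mult_le_cancel_left1)
qed

lemma inverse_log_prod_antimono:
  assumes "X0 \<le> x" "x \<le> y" "1 \<le> k" "k \<le> K"
  shows "1 / log_prod k y \<le> 1 / log_prod k x"
proof -
  have "1 \<le> x" using ge1[OF assms(1), of 0] assms by simp
  then show ?thesis
    using log_prod_ge[of x k] log_prod_mono[of x y k] assms by (intro divide_left_mono) auto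
qed

text \<open>All \<open>1 / log_prod k\<close> involved are nonincreasing, so the drift with
  \<open>\<bar>B\<bar>\<close> decreases by at least the oscillation of the drift with
  \<open>B\<close>; it takes the role of \<open>G\<close>.\<close>

lemma log_drift_osc:
  assumes "X0 \<le> x" "x \<le> y" "1 \<le> K"
  shows "\<bar>log_drift K B x - log_drift K B y\<bar> \<le> log_drift K \<bar>B\<bar> x - log_drift K \<bar>B\<bar> y"
proof -
  have eq: "log_drift K C x - log_drift K C y =
      (\<Sum>m<K - 1. 1 / log_prod (Suc m) x - 1 / log_prod (Suc m) y) + C * (1 / log_prod K x - 1 / log_prod K y)" for C
    by (simp add: log_drift_def sum_subtractf algebra_simps)
  have "0 \<le> (\<Sum>m<K - 1. 1 / log_prod (Suc m) x - 1 / log_prod (Suc m) y)"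
    using inverse_log_prod_antimono[OF assms(1,2)] by (intro sum_nonneg) auto
  moreover have "\<bar>B * (1 / log_prod K x - 1 / log_prod K y)\<bar> = \<bar>B\<bar> * (1 / log_prod K x - 1 / log_prod K y)"
    using inverse_log_prod_antimono[OF assms(1,2), of K] assms(3) by (simp add: abs_mult)
  ultimately show ?thesis unfolding eq by linarith
qed

lemma log_drift_bounds:
  assumes "X0 \<le> x" "1 \<le> K"
  shows "0 \<le> log_drift K \<bar>B\<bar> x" "\<bar>log_drift K B x\<bar> \<le> (real K + \<bar>B\<bar>) / x"
proof -
  have x: "1 \<le> x" using ge1[OF assms(1), of 0] assms by simp
  have inv: "0 < 1 / log_prod k x" "1 / log_prod k x \<le> 1 / x" if "1 \<le> k" "k \<le> K" for k
    using log_prod_ge[OF assms(1) that] x by (auto intro!: divide_left_mono)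
  have s0: "0 \<le> (\<Sum>m<K - 1. 1 / log_prod (Suc m) x)"
    by (intro sum_nonneg less_imp_le[OF inv(1)]) auto
  have "(\<Sum>m<K - 1. 1 / log_prod (Suc m) x) \<le> (\<Sum>m<K - 1. 1 / x)"
    by (intro sum_mono inv(2)) auto
  also have "\<dots> \<le> real K / x" using x by (simp add: divide_right_mono)
  finally have s1: "(\<Sum>m<K - 1. 1 / log_prod (Suc m) x) \<le> real K / x" .
  have B: "0 \<le> \<bar>B\<bar> / log_prod K x" "\<bar>B\<bar> / log_prod K x \<le> \<bar>B\<bar> / x"
    using mult_left_mono[OF inv(2)[of K], of "\<bar>B\<bar>"] mult_left_mono[OF less_imp_le[OF inv(1)[of K]], of "\<bar>B\<bar>"] assms(2)
    by auto
  have "\<bar>B / log_prod K x\<bar> = \<bar>B\<bar> / log_prod K x"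
    using inv(1)[of K] assms(2) by (simp add: abs_divide)
  with s0 s1 B show "0 \<le> log_drift K \<bar>B\<bar> x" "\<bar>log_drift K B x\<bar> \<le> (real K + \<bar>B\<bar>) / x"
    unfolding log_drift_def by (auto simp: add_divide_distrib)
qed

end

text \<open>The leading term of the drift is \<open>1/x\<close>, all others being smaller by a factor \<open>log x\<close>.\<close>

lemma log_drift_times_tendsto:
  assumes "2 \<le> K"
  shows "((\<lambda>x. x * log_drift K B x) \<longlongrightarrow> 1) at_top"
proof -
  have tail: "((\<lambda>x. x * (1 / log_prod k x)) \<longlongrightarrow> 0) at_top" if "2 \<le> k" for k
  proof (rule Lim_null_comparison)
    show "((\<lambda>x. 1 / ln x) \<longlongrightarrow> (0::real)) at_top"
      by (intro real_tendsto_divide_at_top[OF tendsto_const] ln_at_top)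
    show "\<forall>\<^sub>F x in at_top. norm (x * (1 / log_prod k x)) \<le> 1 / ln x"
      using eventually_iter_log_ge[of k 1]
    proof eventually_elim
      case (elim x)
      then have ge: "1 \<le> x" "1 \<le> ln x" using that elim[rule_format, of 0] elim[rule_format, of 1] by (auto simp: iter_log_Suc)
      have "{..<k} = insert 0 (insert 1 {2..<k})" using that by auto
      then have prod: "log_prod k x = x * (ln x * (\<Prod>j\<in>{2..<k}. iter_log j x))"
        by (simp add: log_prod_def iter_log_Suc)
      have "1 \<le> (\<Prod>j\<in>{2..<k}. iter_log j x)" using elim by (intro prod_ge_1) auto
      then have le: "ln x \<le> ln x * (\<Prod>j\<in>{2..<k}. iter_log j x)"
        using ge by (simp add: mult_le_cancel_left1)
      then have "0 < ln x * (\<Prod>j\<in>{2..<k}. iter_log j x)" using ge by linarith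
      moreover have "1 / (ln x * (\<Prod>j\<in>{2..<k}. iter_log j x)) \<le> 1 / ln x"
        by (rule frac_le) (use ge le in linarith)+
      ultimately show ?case unfolding prod using ge by (simp add: abs_of_pos)
    qed
  qed
  have "((\<lambda>x. x * (1 / log_prod (Suc 0) x)) \<longlongrightarrow> 1) at_top"
  proof (rule tendsto_eventually)
    show "\<forall>\<^sub>F x in at_top. x * (1 / log_prod (Suc 0) x) = 1"
      using eventually_gt_at_top[of 0] by eventually_elim (simp add: log_prod_def)
  qed
  then have "((\<lambda>x. x * (1 / log_prod (Suc 0) x) + (\<Sum>m\<in>{1..<K - 1}. x * (1 / log_prod (Suc m) x))
      + B * (x * (1 / log_prod K x))) \<longlongrightarrow> 1 + (\<Sum>m\<in>{1..<K - 1}. 0) + B * 0) at_top"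
    using assms by (intro tendsto_intros tail) auto
  moreover have "x * log_drift K B x = x * (1 / log_prod (Suc 0) x) + (\<Sum>m\<in>{1..<K - 1}. x * (1 / log_prod (Suc m) x))
      + B * (x * (1 / log_prod K x))" for x
  proof -
    have "(\<Sum>m<K - 1. 1 / log_prod (Suc m) x) = 1 / log_prod (Suc 0) x + (\<Sum>m\<in>{1..<K - 1}. 1 / log_prod (Suc m) x)"
      unfolding lessThan_atLeast0 using assms by (subst sum.atLeast_Suc_lessThan) auto
    then show ?thesis by (simp add: log_drift_def sum_distrib_left algebra_simps)
  qed
  ultimately show ?thesis by simp
qed

section \<open>Asymptotics of the excursion maximum\<close>

text \<open>The sign \<open>s\<close> covers both parts of the theorem, since the bounds on
  oscillation and size are unaffected by it.\<close>

lemma perturbed_weights_log: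
  fixes s :: real
  assumes "random_walk_12 P p q Y" "1 \<le> K"
    and p_eq: "\<forall>\<^sub>F n in sequentially. p n = 1 / 3 + s * Lambda K n B / 3" and s: "\<bar>s\<bar> = 1"
    and ge1: "\<And>x j. X0 \<le> x \<Longrightarrow> j \<le> K \<Longrightarrow> 1 \<le> iter_log j x"
  shows "perturbed_weights (\<lambda>i. p i / q i) (\<lambda>i. 3 * p i - 1) (\<lambda>x. s * log_potential K B x)
    (\<lambda>x. s * log_drift K B x) (log_drift K \<bar>B\<bar>) X0 (real K + \<bar>B\<bar>)"
proof -
  interpret random_walk_12 P p q Y by fact
  note osc = log_drift_osc[of X0 K, OF ge1] and bounds = log_drift_bounds[of X0 K, OF ge1]
  show ?thesis
  proof
    fix i :: nat assume i: "2 \<le> i"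
    have q: "q i = 1 - p i" using q_plus_p[OF i] by simp
    show "p i / q i = (1 + (3 * p i - 1)) / (2 - (3 * p i - 1))"
      using q_pos[OF i] unfolding q by (simp add: divide_simps)
    show "-1 < 3 * p i - 1" "3 * p i - 1 < 2" using p_pos[OF i] q_pos[OF i] q by auto
  next
    show "\<forall>\<^sub>F i in sequentially. 3 * p i - 1 = s * log_drift K B (real i)"
      using p_eq by eventually_elim (simp add: Lambda_eq_log_drift)
    show "0 < X0" using ge1[of X0 0] by simp
  next
    fix x assume x: "X0 \<le> x"
    show "((\<lambda>x. s * log_potential K B x) has_real_derivative s * log_drift K B x) (at x)"
      by (intro DERIV_cmult has_real_derivative_log_potential)
        (use ge1[OF x] in \<open>force intro: less_le_trans[OF zero_less_one]\<close>)
    show "\<bar>s * log_drift K B x\<bar> \<le> (real K + \<bar>B\<bar>) / x"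
      using bounds(2)[OF _ _ x \<open>1 \<le> K\<close>] s by (simp add: abs_mult)
    show "0 \<le> log_drift K \<bar>B\<bar> x" using bounds(1)[OF _ _ x \<open>1 \<le> K\<close>] by simp
  next
    fix x y assume "X0 \<le> x" "x \<le> y"
    then have "\<bar>log_drift K B x - log_drift K B y\<bar> \<le> log_drift K \<bar>B\<bar> x - log_drift K \<bar>B\<bar> y"
      using osc[of x y B] \<open>1 \<le> K\<close> by simp
    then show "\<bar>s * log_drift K B x - s * log_drift K B y\<bar> \<le> log_drift K \<bar>B\<bar> x - log_drift K \<bar>B\<bar> y"
      using s by (simp add: abs_mult flip: right_diff_distrib)
  qed
qed

lemma obtain_iter_log_ge1:
  obtains X0 where "\<And>x j. X0 \<le> x \<Longrightarrow> j \<le> K \<Longrightarrow> 1 \<le> iter_log j x"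
  using eventually_iter_log_ge[of K 1] unfolding eventually_at_top_linorder by blast

context
  fixes P :: "'a measure" and p q :: "nat \<Rightarrow> real" and Y :: "nat \<Rightarrow> 'a \<Rightarrow> nat"
    and K :: nat and B :: real
  assumes walk: "random_walk_12 P p q Y" and start: "AE \<omega> in P. Y 0 \<omega> = 2" and K: "1 \<le> K"
begin

text \<open>With \<open>L = iter_log (K - 1)\<close>, \<open>exp (- \<psi>)\<close> is
  \<open>L powr (- B)\<close> times the derivative of \<open>L\<close>. An antiderivative is
  \<open>iter_log K\<close> for \<open>B = 1\<close> and \<open>L powr (1 - B) / (1 - B)\<close>
  otherwise, which tends to 0 for \<open>B > 1\<close> and to infinity for
  \<open>B < 1\<close>.\<close>

lemma upward_drift_asymp:
  assumes p_eq: "\<forall>\<^sub>F n in sequentially. p n = 1 / 3 + Lambda K n B / 3"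
  shows "B = 1 \<Longrightarrow> \<exists>c>0. excursion_max_prob P Y \<sim>[at_top]
      (\<lambda>n. c / ((\<Prod>j<K. iter_log j (real n)) * (iter_log K (real n))\<^sup>2))"
    and "B > 1 \<Longrightarrow> \<exists>c>0. excursion_max_prob P Y \<sim>[at_top]
      (\<lambda>n. c / ((\<Prod>j<K - 1. iter_log j (real n)) * iter_log (K - 1) (real n) powr B))"
    and "B < 1 \<Longrightarrow> \<exists>c>0. excursion_max_prob P Y \<sim>[at_top]
      (\<lambda>n. c / ((\<Prod>j<K - 1. iter_log j (real n)) * iter_log (K - 1) (real n) powr (2 - B)))"
proof -
  obtain X0 where ge1: "\<And>x j. X0 \<le> x \<Longrightarrow> j \<le> K \<Longrightarrow> 1 \<le> iter_log j x"
    using obtain_iter_log_ge1 by blast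
  have pos: "0 < iter_log j x" if "X0 \<le> x" "j \<le> K" for x j
    using ge1[OF that] by linarith
  interpret W: perturbed_weights "\<lambda>i. p i / q i" "\<lambda>i. 3 * p i - 1" "log_potential K B"
    "log_drift K B" "log_drift K \<bar>B\<bar>" X0 "real K + \<bar>B\<bar>"
    using perturbed_weights_log[OF walk K _ _ ge1, where s = 1] p_eq by simp
  note increments = random_walk_12.excursion_max_prob_eq[OF walk start]
  have exp_\<psi>: "exp (log_potential K B x) = log_prod (K - 1) x * iter_log (K - 1) x powr B"
    if "X0 \<le> x" for x
    using K pos[OF that] by (intro exp_log_potential) auto
  have L_pos: "0 < log_prod k x" if "X0 \<le> x" "k \<le> K" for k x
    using pos[OF that(1)] that(2) by (intro log_prod_pos) auto
  have eventually_X0: "\<forall>\<^sub>F x in at_top. X0 \<le> x" by (rule eventually_ge_at_top)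
  {
    assume B: "B = 1"
    have log_prod_K: "log_prod K x = log_prod (K - 1) x * iter_log (K - 1) x" for x
      using K by (cases K) (auto simp: log_prod_def)
    have "exp (log_potential K B x) = log_prod K x" if "X0 \<le> x" for x
      using exp_\<psi>[OF that] pos[OF that, of "K - 1"] by (simp add: B log_prod_K)
    note exp_\<psi>1 = this
    have "\<exists>c>0. excursion_max_prob P Y \<sim>[at_top]
        (\<lambda>n. c * (exp (- log_potential K B (real n)) / (iter_log K (real n))\<^sup>2))"
    proof (rule W.escape_asymp_unbounded[OF increments _ _ filterlim_iter_log])
      show "(iter_log K has_real_derivative 1 / log_prod K x) (at x)" if "X0 \<le> x" for x
        using pos[OF that] by (intro has_real_derivative_iter_log) auto
      show "((\<lambda>x. 1 / log_prod K x * exp (log_potential K B x)) \<longlongrightarrow> 1) at_top"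
      proof (rule tendsto_eventually)
        show "\<forall>\<^sub>F x in at_top. 1 / log_prod K x * exp (log_potential K B x) = 1"
          using eventually_X0 by eventually_elim (simp add: exp_\<psi>1 L_pos less_imp_neq[symmetric])
      qed
    qed
    then show "\<exists>c>0. excursion_max_prob P Y \<sim>[at_top]
      (\<lambda>n. c / ((\<Prod>j<K. iter_log j (real n)) * (iter_log K (real n))\<^sup>2))"
    proof (rule asymp_equiv_divideI)
      show "\<forall>\<^sub>F n in sequentially. exp (- log_potential K B (real n)) / (iter_log K (real n))\<^sup>2 =
          1 / ((\<Prod>j<K. iter_log j (real n)) * (iter_log K (real n))\<^sup>2)"
        using eventually_real_ge[of X0]
        by eventually_elim (simp add: exp_minus exp_\<psi>1 divide_inverse flip: log_prod_def)
    qed simp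
  }
  define \<Phi> where "\<Phi> x = iter_log (K - 1) x powr (1 - B) / (1 - B)" for x
  define \<Phi>' where "\<Phi>' x = iter_log (K - 1) x powr (- B) / log_prod (K - 1) x" for x
  have \<Phi>_deriv: "(\<Phi> has_real_derivative \<Phi>' x) (at x)" if "X0 \<le> x" "B \<noteq> 1" for x
  proof -
    have "(iter_log (K - 1) has_real_derivative 1 / log_prod (K - 1) x) (at x)"
      using pos[OF that(1)] by (intro has_real_derivative_iter_log) auto
    from DERIV_chain2[OF has_real_derivative_powr[OF pos[OF that(1), of "K - 1"], where r = "1 - B"] this]
    have "((\<lambda>x. iter_log (K - 1) x powr (1 - B)) has_real_derivative
        (1 - B) * iter_log (K - 1) x powr (1 - B - 1) * (1 / log_prod (K - 1) x)) (at x)" by simp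
    from DERIV_cdivide[OF this, of "1 - B"] that(2) show ?thesis
      unfolding \<Phi>_def[abs_def] \<Phi>'_def by simp
  qed
  have \<Phi>'_lim: "((\<lambda>x. \<Phi>' x * exp (log_potential K B x)) \<longlongrightarrow> 1) at_top"
  proof (rule tendsto_eventually)
    show "\<forall>\<^sub>F x in at_top. \<Phi>' x * exp (log_potential K B x) = 1"
      using eventually_X0
    proof eventually_elim
      case (elim x)
      have "0 < log_prod (K - 1) x" "0 < iter_log (K - 1) x" using L_pos pos elim by auto
      then show ?case unfolding exp_\<psi>[OF elim] \<Phi>'_def by (simp add: powr_minus)
    qed
  qed
  {
    assume B: "B > 1"
    have "((\<lambda>x. iter_log (K - 1) x powr (1 - B) / (1 - B)) \<longlongrightarrow> 0 / (1 - B)) at_top"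
      using B by (intro tendsto_divide tendsto_neg_powr filterlim_iter_log tendsto_const) auto
    then have "(\<Phi> \<longlongrightarrow> 0) at_top" by (simp add: \<Phi>_def[abs_def])
    with B have "\<exists>c>0. excursion_max_prob P Y \<sim>[at_top] (\<lambda>n. c * exp (- log_potential K B (real n)))"
      by (intro W.escape_asymp_bounded[OF increments \<Phi>_deriv \<Phi>'_lim]) auto
    then show "\<exists>c>0. excursion_max_prob P Y \<sim>[at_top]
      (\<lambda>n. c / ((\<Prod>j<K - 1. iter_log j (real n)) * iter_log (K - 1) (real n) powr B))"
    proof (rule asymp_equiv_divideI)
      show "\<forall>\<^sub>F n in sequentially. exp (- log_potential K B (real n)) =
          1 / ((\<Prod>j<K - 1. iter_log j (real n)) * iter_log (K - 1) (real n) powr B)"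
        using eventually_real_ge[of X0]
        by eventually_elim (simp add: exp_minus exp_\<psi> divide_inverse flip: log_prod_def)
    qed simp
  }
  {
    assume B: "B < 1"
    have "filterlim (\<lambda>x::real. x powr (1 - B) / (1 - B)) at_top at_top"
      using B by real_asymp
    from filterlim_compose[OF this filterlim_iter_log[of "K - 1"]]
    have "filterlim \<Phi> at_top at_top" by (simp add: \<Phi>_def[abs_def])
    with B have "\<exists>c>0. excursion_max_prob P Y \<sim>[at_top]
        (\<lambda>n. c * (exp (- log_potential K B (real n)) / (\<Phi> (real n))\<^sup>2))"
      by (intro W.escape_asymp_unbounded[OF increments \<Phi>_deriv \<Phi>'_lim]) auto
    then show "\<exists>c>0. excursion_max_prob P Y \<sim>[at_top]
      (\<lambda>n. c / ((\<Prod>j<K - 1. iter_log j (real n)) * iter_log (K - 1) (real n) powr (2 - B)))"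
    proof (rule asymp_equiv_divideI)
      show "0 < (1 - B)\<^sup>2" using B by simp
      show "\<forall>\<^sub>F n in sequentially. exp (- log_potential K B (real n)) / (\<Phi> (real n))\<^sup>2 =
          (1 - B)\<^sup>2 / ((\<Prod>j<K - 1. iter_log j (real n)) * iter_log (K - 1) (real n) powr (2 - B))"
        using eventually_real_ge[of X0]
      proof eventually_elim
        case (elim n)
        let ?L = "iter_log (K - 1) (real n)"
        have L: "0 < ?L" using pos elim by simp
        \<comment> \<open>The exponent \<open>2 - B\<close> is \<open>B\<close> from the potential
          plus twice \<open>1 - B\<close> from the square of \<open>\<Phi>\<close>.\<close>
        have L_powr: "?L powr (2 - B) = ?L powr B * (?L powr (1 - B))\<^sup>2"
          using L by (simp add: power2_eq_square flip: powr_add)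
        show ?case
          unfolding log_prod_def[symmetric] exp_minus exp_\<psi>[OF elim] \<Phi>_def L_powr
          by (simp add: power_divide divide_inverse power_mult_distrib power_inverse)
      qed
    qed
  }
qed

text \<open>The sign of the potential is reversed, so \<open>\<Phi>'\<close> must be asymptotic to
  \<open>exp ?\<psi>\<close>. For \<open>2 \<le> K\<close>, \<open>x * ?l x\<close> tends to 1, so
  \<open>x * exp (?\<psi> x)\<close> has a derivative asymptotic to
  \<open>2 * exp (?\<psi> x)\<close>; hence the factor 1/2 in \<open>\<Phi>\<close>.\<close>

lemma downward_drift_asymp:
  assumes p_eq: "\<forall>\<^sub>F n in sequentially. p n = 1 / 3 - Lambda K n B / 3" and K2: "2 \<le> K"
  shows "\<exists>c>0. excursion_max_prob P Y \<sim>[at_top]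
      (\<lambda>n. c / (real n ^ 3 * (\<Prod>j\<in>{1..<K - 1}. iter_log j (real n)) * iter_log (K - 1) (real n) powr B))"
proof -
  obtain X0 where ge1: "\<And>x j. X0 \<le> x \<Longrightarrow> j \<le> K \<Longrightarrow> 1 \<le> iter_log j x"
    using obtain_iter_log_ge1 by blast
  have pos: "0 < iter_log j x" if "X0 \<le> x" "j \<le> K" for x j
    using ge1[OF that] by linarith
  let ?\<psi> = "log_potential K B" and ?l = "log_drift K B"
  interpret W: perturbed_weights "\<lambda>i. p i / q i" "\<lambda>i. 3 * p i - 1" "\<lambda>x. - 1 * ?\<psi> x"
    "\<lambda>x. - 1 * ?l x" "log_drift K \<bar>B\<bar>" X0 "real K + \<bar>B\<bar>"
    by (rule perturbed_weights_log[OF walk K _ _ ge1]) (use p_eq in auto)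
  have \<psi>_deriv: "(?\<psi> has_real_derivative ?l x) (at x)" if "X0 \<le> x" for x
    using pos[OF that] by (intro has_real_derivative_log_potential) auto
  define \<Phi> where "\<Phi> x = x * exp (?\<psi> x) / 2" for x
  define \<Phi>' where "\<Phi>' x = (exp (?\<psi> x) + x * (exp (?\<psi> x) * ?l x)) / 2" for x
  have \<Phi>_deriv: "(\<Phi> has_real_derivative \<Phi>' x) (at x)" if "X0 \<le> x" for x
    unfolding \<Phi>_def \<Phi>'_def
    by (auto intro!: derivative_eq_intros \<psi>_deriv[OF that])
  have lim: "((\<lambda>x. x * ?l x) \<longlongrightarrow> 1) at_top" by (rule log_drift_times_tendsto[OF K2])
  have "((\<lambda>x. (1 + x * ?l x) / 2) \<longlongrightarrow> (1 + 1) / 2) at_top"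
    by (intro tendsto_intros lim) auto
  moreover have "(1 + x * ?l x) / 2 = \<Phi>' x * exp (- 1 * ?\<psi> x)" for x
    by (simp add: \<Phi>'_def exp_minus field_simps)
  ultimately have \<Phi>'_lim: "((\<lambda>x. \<Phi>' x * exp (- 1 * ?\<psi> x)) \<longlongrightarrow> 1) at_top" by simp
  have "\<forall>\<^sub>F x in at_top. 0 < x * ?l x" by (rule order_tendstoD[OF lim]) simp
  then obtain X1 where X1: "\<And>x. X1 \<le> x \<Longrightarrow> 0 < x * ?l x"
    unfolding eventually_at_top_linorder by blast
  define X2 where "X2 = max X0 X1"
  \<comment> \<open>Beyond \<open>X2\<close> the function \<open>?l\<close> is positive, so
    \<open>?\<psi>\<close> does not decrease and \<open>\<Phi>\<close> grows at least
    linearly.\<close>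
  have \<psi>_ge: "?\<psi> X2 \<le> ?\<psi> x" if "X2 \<le> x" for x
  proof (rule DERIV_nonneg_imp_nondecreasing[OF that])
    fix y assume "X2 \<le> y"
    then have y: "X0 \<le> y" "0 < y * ?l y" "0 < y" using X1[of y] W.X0 by (auto simp: X2_def)
    then show "\<exists>d. (?\<psi> has_real_derivative d) (at y) \<and> 0 \<le> d"
      using \<psi>_deriv[OF y(1)] by (auto simp: zero_less_mult_iff)
  qed
  have "filterlim (\<lambda>x. x * exp (?\<psi> X2) / 2) at_top at_top" by real_asymp
  then have \<Phi>_top: "filterlim \<Phi> at_top at_top"
  proof (rule filterlim_at_top_mono)
    show "\<forall>\<^sub>F x in at_top. x * exp (?\<psi> X2) / 2 \<le> \<Phi> x"
      using eventually_ge_at_top[of X2] eventually_ge_at_top[of 0]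
    proof eventually_elim
      case (elim x)
      then show ?case unfolding \<Phi>_def using \<psi>_ge[of x] by (intro divide_right_mono mult_left_mono) auto
    qed
  qed
  have "\<exists>c>0. excursion_max_prob P Y \<sim>[at_top]
      (\<lambda>n. c * (exp (- (- 1 * ?\<psi> (real n))) / (\<Phi> (real n))\<^sup>2))"
    by (rule W.escape_asymp_unbounded[OF random_walk_12.excursion_max_prob_eq[OF walk start] \<Phi>_deriv \<Phi>'_lim \<Phi>_top])
  then show ?thesis
  proof (rule asymp_equiv_divideI)
    show "(0::real) < 4" by simp
    show "\<forall>\<^sub>F n in sequentially. exp (- (- 1 * ?\<psi> (real n))) / (\<Phi> (real n))\<^sup>2 =
        4 / (real n ^ 3 * (\<Prod>j\<in>{1..<K - 1}. iter_log j (real n)) * iter_log (K - 1) (real n) powr B)"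
      using eventually_real_ge[of X0]
    proof eventually_elim
      case (elim n)
      let ?Q = "\<Prod>j\<in>{1..<K - 1}. iter_log j (real n)"
      have prod: "log_prod (K - 1) (real n) = real n * ?Q"
        unfolding log_prod_def lessThan_atLeast0 using K2 by (subst prod.atLeast_Suc_lessThan) auto
      have "exp (?\<psi> (real n)) = log_prod (K - 1) (real n) * iter_log (K - 1) (real n) powr B"
        using K pos[OF elim] by (intro exp_log_potential) auto
      then have e: "real n ^ 3 * ?Q * iter_log (K - 1) (real n) powr B = real n ^ 2 * exp (?\<psi> (real n))"
        unfolding prod by (simp add: power2_eq_square power3_eq_cube)
      show ?case unfolding e \<Phi>_def by (simp add: power2_eq_square divide_simps)
    qed
  qed
qed

end

lemma eventually_perturbation: "\<forall>\<^sub>F n in sequentially. perturbation K B n = Lambda K n B / 3"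
  using eventually_ge_at_top[of "first_index K B"]
  by eventually_elim (simp add: perturbation_def max_absorb1)

theorem theorem3:
  fixes P :: "'a measure" and p q :: "nat \<Rightarrow> real" and Y :: "nat \<Rightarrow> 'a \<Rightarrow> nat"
    and K :: nat and B :: real
  assumes "1 \<le> K"
    and "random_walk_12 P p q Y"
    and "AE \<omega> in P. Y 0 \<omega> = 2"
  shows "((\<forall>i\<ge>2. p i = 1/3 + perturbation K B i \<and> q i = 1 - p i) \<longrightarrow>
      (B = 1 \<longrightarrow> (\<exists>c>0. excursion_max_prob P Y \<sim>[at_top]
        (\<lambda>n. c / ((\<Prod>j<K. iter_log j (real n)) * (iter_log K (real n))\<^sup>2)))) \<and>
      (B > 1 \<longrightarrow> (\<exists>c>0. excursion_max_prob P Y \<sim>[at_top]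
        (\<lambda>n. c / ((\<Prod>j<K - 1. iter_log j (real n)) * iter_log (K - 1) (real n) powr B)))) \<and>
      (B < 1 \<longrightarrow> (\<exists>c>0. excursion_max_prob P Y \<sim>[at_top]
        (\<lambda>n. c / ((\<Prod>j<K - 1. iter_log j (real n)) * iter_log (K - 1) (real n) powr (2 - B)))))) \<and>
    ((\<forall>i\<ge>2. p i = 1/3 - perturbation K B i \<and> q i = 1 - p i) \<longrightarrow>
      (K = 1 \<and> B > -1 \<longrightarrow> (\<exists>c>0. excursion_max_prob P Y \<sim>[at_top] (\<lambda>n. c / real n powr (B + 2)))) \<and>
      (K = 1 \<and> B = -1 \<longrightarrow> (\<exists>c>0. excursion_max_prob P Y \<sim>[at_top] (\<lambda>n. c / (real n * (ln (real n))\<^sup>2)))) \<and>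
      (K = 1 \<and> B < -1 \<longrightarrow> (\<exists>c>0. excursion_max_prob P Y \<sim>[at_top] (\<lambda>n. c * real n powr B))) \<and>
      (K > 1 \<longrightarrow> (\<exists>c>0. excursion_max_prob P Y \<sim>[at_top]
        (\<lambda>n. c / (real n ^ 3 * (\<Prod>j\<in>{1..<K - 1}. iter_log j (real n))
               * iter_log (K - 1) (real n) powr B)))))"
proof (intro conjI impI; (elim conjE)?)
  note walk = assms(2) and start = assms(3)
  {
    assume "\<forall>i\<ge>2. p i = 1/3 + perturbation K B i \<and> q i = 1 - p i"
    then have p_eq: "p n = 1/3 + perturbation K B n" if "2 \<le> n" for n using that by blast
    have "\<forall>\<^sub>F n in sequentially. p n = 1 / 3 + Lambda K n B / 3"
      using eventually_perturbation[of K B] eventually_ge_at_top[of 2]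
      by eventually_elim (simp add: p_eq)
    note up = upward_drift_asymp[OF walk start assms(1) this]
    {
      assume "B = 1"
      then show "\<exists>c>0. excursion_max_prob P Y \<sim>[at_top]
        (\<lambda>n. c / ((\<Prod>j<K. iter_log j (real n)) * (iter_log K (real n))\<^sup>2))" by (rule up)
    next
      assume "B > 1"
      then show "\<exists>c>0. excursion_max_prob P Y \<sim>[at_top]
        (\<lambda>n. c / ((\<Prod>j<K - 1. iter_log j (real n)) * iter_log (K - 1) (real n) powr B))" by (rule up)
    next
      assume "B < 1"
      then show "\<exists>c>0. excursion_max_prob P Y \<sim>[at_top]
        (\<lambda>n. c / ((\<Prod>j<K - 1. iter_log j (real n)) * iter_log (K - 1) (real n) powr (2 - B)))" by (rule up)
    }
  next
    assume "\<forall>i\<ge>2. p i = 1/3 - perturbation K B i \<and> q i = 1 - p i"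
    then have p_eq: "p n = 1/3 - perturbation K B n" if "2 \<le> n" for n using that by blast
    have down: "\<forall>\<^sub>F n in sequentially. p n = 1 / 3 - Lambda K n B / 3"
      using eventually_perturbation[of K B] eventually_ge_at_top[of 2]
      by eventually_elim (simp add: p_eq)
    {
      assume "K > 1"
      then show "\<exists>c>0. excursion_max_prob P Y \<sim>[at_top]
        (\<lambda>n. c / (real n ^ 3 * (\<Prod>j\<in>{1..<K - 1}. iter_log j (real n))
               * iter_log (K - 1) (real n) powr B))"
        by (intro downward_drift_asymp[OF walk start assms(1) down]) simp
    next
      \<comment> \<open>For \<open>K = 1\<close> the perturbation is a multiple of \<open>B\<close>,
        so subtracting it is the upward case with \<open>- B\<close>; the threshold 1 becomes
        -1.\<close>
      assume K: "K = 1"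
      have "\<forall>\<^sub>F n in sequentially. p n = 1 / 3 + Lambda 1 n (- B) / 3"
        using down by eventually_elim (simp add: K Lambda_def)
      note up = upward_drift_asymp[OF walk start order_refl this]
      {
        assume "B > -1"
        then show "\<exists>c>0. excursion_max_prob P Y \<sim>[at_top] (\<lambda>n. c / real n powr (B + 2))"
          using up(3) by (simp add: add.commute)
      next
        assume "B = -1"
        then show "\<exists>c>0. excursion_max_prob P Y \<sim>[at_top] (\<lambda>n. c / (real n * (ln (real n))\<^sup>2))"
          using up(1) by (simp add: iter_log_Suc)
      next
        assume "B < -1"
        then show "\<exists>c>0. excursion_max_prob P Y \<sim>[at_top] (\<lambda>n. c * real n powr B)"
          using up(2) by (simp add: powr_minus divide_inverse)
      }
    }
  }
qed

end
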